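(* Let $(X_1,x_1)$ and $(X_2,x_2)$ be two pointed spaces and $(X,x_* )=(X_1,x_1)\vee(X_2,x_2)$. If $X$ is semilocally $1$-simply connected at $x_*$, then $$\mathcal{H}_1(X,x_* )\cong j_*\mathcal{H}_1(U_1\vee U_2,x_* )\ltimes{\prod_{\mathbb{N}}}^{W}\pi_1(X,x_* )$$ for some neighbourhood $U_1\vee U_2$ of $x_*$ in $X$ (with $U_i$ a neighbourhood of $x_i$ in $X_i$, $i=1,2$), where $j:U_1\vee U_2\to X$ is the inclusion map.
   Context: The Hawaiian earring is $\mathbb{HE}^1=\{(r_0,r_1)\in\mathbb{R}^{2} : (r_0-1/k)^2+r_1^2=(1/k)^2 \text{ for some } k\in\mathbb{N}\}$, with base point $\theta=(0,0)$; $\mathbb{S}^1_k$ denotes its circle of radius $1/k$. All homotopies are relative to base points. The first Hawaiian group $\mathcal{H}_1(X,x_0)$ is the set of pointed homotopy classes $[f]$ of pointed maps $f:(\mathbb{HE}^1,\theta)\to(X,x_0)$, with the operation induced circle by circle from that of the fundamental group: $[f][g]=[f*g]$, where $(f*g)|_{\mathbb{S}^1_k}=f|_{\mathbb{S}^1_k}*g|_{\mathbb{S}^1_k}$ for all $k$. A pointed map $\beta$ induces a homomorphism $\beta_*:[f]\mapsto[\beta\circ f]$ of Hawaiian groups; in particular $j_*\mathcal{H}_1(U_1\vee U_2,x_* )$ is a subgroup of $\mathcal{H}_1(X,x_* )$. $\prod^W_{\mathbb{N}}G$ denotes the weak direct product: the subgroup of $\prod_{\mathbb{N}}G$ of tuples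 with all but finitely many components trivial. $\prod^W_{\mathbb{N}}\pi_1(X,x_0)$ is regarded as a normal subgroup of $\mathcal{H}_1(X,x_0)$, namely the classes having a representative $f$ that is constant on $\mathbb{S}^1_k$ for all but finitely many $k$. $H\ltimes N$ denotes a semidirect product with $N$ as the normal factor. $X$ is semilocally $n$-simply connected at $x$ if there is a neighbourhood $U$ of $x$ such that the homomorphism $\pi_n(U,x)\to\pi_n(X,x)$ induced by inclusion is trivial. *)

theory Defs
  imports "HOL-Analysis.Analysis" "HOL-Algebra.Bij" "HOL-Algebra.Product_Groups"
begin

section \<open>Topological preliminaries\<close>

text \<open>A neighbourhood need not be open.\<close>

definition neighbourhood_in :: "'a topology \<Rightarrow> 'a \<Rightarrow> 'a set \<Rightarrow> bool" where
  "neighbourhood_in X x U \<longleftrightarrow> U \<subseteq> topspace X \<and> (\<exists>V. openin X V \<and> x \<in> V \<and> V \<subseteq> U)"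

definition disjoint_sum_topology :: "'a topology \<Rightarrow> 'b topology \<Rightarrow> ('a + 'b) topology" where
  "disjoint_sum_topology X Y = topology (\<lambda>U. U \<subseteq> topspace X <+> topspace Y \<and>
     openin X (Inl -` U) \<and> openin Y (Inr -` U))"

definition quotient_topology :: "'a topology \<Rightarrow> ('a \<Rightarrow> 'b) \<Rightarrow> 'b topology" where
  "quotient_topology X q =
     topology (\<lambda>U. U \<subseteq> q ` topspace X \<and> openin X {x \<in> topspace X. q x \<in> U})"

text \<open>The one-point union is the quotient of the disjoint sum identifying \<open>Inr y\<close> with \<open>Inl x\<close>;
  the class \<open>{Inl x, Inr y}\<close> is represented by \<open>Inl x\<close> and every other class is a singleton.
  In particular the points of a wedge of subspaces are points of the whole wedge, so that the
  inclusion map is the identity function.\<close>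

definition wedge_collapse :: "'a \<Rightarrow> 'b \<Rightarrow> 'a + 'b \<Rightarrow> 'a + 'b" where
  "wedge_collapse x y p = (if p = Inr y then Inl x else p)"

definition wedge :: "'a topology \<Rightarrow> 'a \<Rightarrow> 'b topology \<Rightarrow> 'b \<Rightarrow> ('a + 'b) topology" where
  "wedge X x Y y = quotient_topology (disjoint_sum_topology X Y) (wedge_collapse x y)"

lemma openin_disjoint_sum_topology:
  "openin (disjoint_sum_topology X Y) U \<longleftrightarrow>
     U \<subseteq> topspace X <+> topspace Y \<and> openin X (Inl -` U) \<and> openin Y (Inr -` U)"
proof -
  have "istopology (\<lambda>U. U \<subseteq> topspace X <+> topspace Y \<and> openin X (Inl -` U) \<and> openin Y (Inr -` U))"
    unfolding istopology_def by (auto simp: vimage_Union)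
  then show ?thesis
    unfolding disjoint_sum_topology_def by (simp add: topology_inverse')
qed

lemma openin_quotient_topology:
  "openin (quotient_topology X q) U \<longleftrightarrow>
     U \<subseteq> q ` topspace X \<and> openin X {x \<in> topspace X. q x \<in> U}"
proof -
  have 1: "{x \<in> topspace X. q x \<in> S \<inter> T} = {x \<in> topspace X. q x \<in> S} \<inter> {x \<in> topspace X. q x \<in> T}"
    for S T by auto
  have 2: "{x \<in> topspace X. q x \<in> \<Union>K} = (\<Union>S\<in>K. {x \<in> topspace X. q x \<in> S})" for K by auto
  have "istopology (\<lambda>U. U \<subseteq> q ` topspace X \<and> openin X {x \<in> topspace X. q x \<in> U})"
    unfolding istopology_def 1 2 by blast
  then show ?thesis
    unfolding quotient_topology_def by (simp add: topology_inverse')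
qed

lemma topspace_disjoint_sum_topology:
  "topspace (disjoint_sum_topology X Y) = topspace X <+> topspace Y"
proof -
  have "Inl -` (topspace X <+> topspace Y) = topspace X"
    and "Inr -` (topspace X <+> topspace Y) = topspace Y" by auto
  then have "openin (disjoint_sum_topology X Y) (topspace X <+> topspace Y)"
    by (simp add: openin_disjoint_sum_topology)
  then show ?thesis
    by (meson openin_disjoint_sum_topology openin_subset openin_topspace subset_antisym)
qed

lemma topspace_quotient_topology: "topspace (quotient_topology X q) = q ` topspace X"
proof -
  have "{x \<in> topspace X. q x \<in> q ` topspace X} = topspace X" by auto
  then have "openin (quotient_topology X q) (q ` topspace X)"
    by (simp add: openin_quotient_topology)
  then show ?thesis
    by (meson openin_quotient_topology openin_subset openin_topspace subset_antisym)
qed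

lemma quotient_map_quotient_topology: "quotient_map X (quotient_topology X q) q"
  by (auto simp: quotient_map_def topspace_quotient_topology openin_quotient_topology)


section \<open>The fundamental group\<close>

definition loops :: "'a topology \<Rightarrow> 'a \<Rightarrow> (real \<Rightarrow> 'a) set" where
  "loops X x = {p. pathin X p \<and> p 0 = x \<and> p 1 = x}"

definition loop_homotopic :: "'a topology \<Rightarrow> 'a \<Rightarrow> ((real \<Rightarrow> 'a) \<times> (real \<Rightarrow> 'a)) set" where
  "loop_homotopic X x =
     {(p, q). homotopic_with (\<lambda>r. r 0 = x \<and> r 1 = x) (top_of_set {0..1}) X p q}"

text \<open>This is \<open>joinpaths\<close> without its type class constraint.\<close>

definition loop_concat :: "(real \<Rightarrow> 'a) \<Rightarrow> (real \<Rightarrow> 'a) \<Rightarrow> real \<Rightarrow> 'a" where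
  "loop_concat p q = (\<lambda>t. if t \<le> 1/2 then p (2 * t) else q (2 * t - 1))"

definition fundamental_group :: "'a topology \<Rightarrow> 'a \<Rightarrow> (real \<Rightarrow> 'a) set monoid" where
  "fundamental_group X x =
     \<lparr>carrier = loops X x // loop_homotopic X x,
      mult = (\<lambda>A B. \<Union>p\<in>A. \<Union>q\<in>B. loop_homotopic X x `` {loop_concat p q}),
      one = loop_homotopic X x `` {\<lambda>t. x}\<rparr>"

text \<open>For a pointed map \<open>\<beta>\<close> into \<open>(Y, y)\<close>, the induced map \<open>[p] \<mapsto> [\<beta> \<circ> p]\<close>.\<close>

definition fundamental_group_map ::
    "'b topology \<Rightarrow> 'b \<Rightarrow> ('a \<Rightarrow> 'b) \<Rightarrow> (real \<Rightarrow> 'a) set \<Rightarrow> (real \<Rightarrow> 'b) set" where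
  "fundamental_group_map Y y \<beta> A = (\<Union>p\<in>A. loop_homotopic Y y `` {\<beta> \<circ> p})"

definition semilocally_1_simply_connected_at :: "'a topology \<Rightarrow> 'a \<Rightarrow> bool" where
  "semilocally_1_simply_connected_at X x \<longleftrightarrow>
     (\<exists>U. neighbourhood_in X x U \<and>
        trivial_homomorphism (fundamental_group (subtopology X U) x) (fundamental_group X x)
          (fundamental_group_map X x (\<lambda>z. z)))"


section \<open>The Hawaiian earring and the first Hawaiian group\<close>

definition hawaiian_earring :: "(real \<times> real) set" where
  "hawaiian_earring = {(a, b). \<exists>k::nat. k \<ge> 1 \<and> (a - 1 / k)\<^sup>2 + b\<^sup>2 = (1 / k)\<^sup>2}"

text \<open>The circle of radius \<open>1/k\<close> through the origin, run through once as a loop based at the origin.\<close>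

definition he_circle :: "nat \<Rightarrow> real \<Rightarrow> real \<times> real" where
  "he_circle k t = ((1 - cos (2 * pi * t)) / k, sin (2 * pi * t) / k)"

definition hawaiian_maps :: "'a topology \<Rightarrow> 'a \<Rightarrow> (real \<times> real \<Rightarrow> 'a) set" where
  "hawaiian_maps X x = {f. continuous_map (top_of_set hawaiian_earring) X f \<and> f (0, 0) = x}"

definition hawaiian_homotopic ::
    "'a topology \<Rightarrow> 'a \<Rightarrow> ((real \<times> real \<Rightarrow> 'a) \<times> (real \<times> real \<Rightarrow> 'a)) set" where
  "hawaiian_homotopic X x =
     {(f, g). homotopic_with (\<lambda>h. h (0, 0) = x) (top_of_set hawaiian_earring) X f g}"

text \<open>A point of the earring other than the origin is \<open>he_circle k t\<close> for exactly one \<open>k \<ge> 1\<close> and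
  one \<open>t\<close> in \<open>{0..1}\<close>. At the origin \<open>k\<close> is arbitrary and \<open>t\<close> is an endpoint, so the choice does not
  matter for maps sending the origin to the same point; see \<open>he_concat_circle\<close>.\<close>

definition he_coords :: "real \<times> real \<Rightarrow> nat \<times> real" where
  "he_coords z = (SOME (k, t). k \<ge> 1 \<and> t \<in> {0..1} \<and> he_circle k t = z)"

definition he_concat ::
    "(real \<times> real \<Rightarrow> 'a) \<Rightarrow> (real \<times> real \<Rightarrow> 'a) \<Rightarrow> real \<times> real \<Rightarrow> 'a" where
  "he_concat f g z =
     (case he_coords z of (k, t) \<Rightarrow> loop_concat (f \<circ> he_circle k) (g \<circ> he_circle k) t)"

definition hawaiian_group :: "'a topology \<Rightarrow> 'a \<Rightarrow> (real \<times> real \<Rightarrow> 'a) set monoid" where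
  "hawaiian_group X x =
     \<lparr>carrier = hawaiian_maps X x // hawaiian_homotopic X x,
      mult = (\<lambda>A B. \<Union>f\<in>A. \<Union>g\<in>B. hawaiian_homotopic X x `` {he_concat f g}),
      one = hawaiian_homotopic X x `` {\<lambda>z. x}\<rparr>"

definition hawaiian_group_map ::
    "'b topology \<Rightarrow> 'b \<Rightarrow> ('a \<Rightarrow> 'b) \<Rightarrow> (real \<times> real \<Rightarrow> 'a) set \<Rightarrow> (real \<times> real \<Rightarrow> 'b) set" where
  "hawaiian_group_map Y y \<beta> A = (\<Union>f\<in>A. hawaiian_homotopic Y y `` {\<beta> \<circ> f})"

text \<open>The weak direct product of copies of the fundamental group indexed by the circles, and its
  canonical embedding in the Hawaiian group: a tuple \<open>n\<close> goes to the class of the maps that are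
  constant on all but finitely many circles and represent \<open>n k\<close> on the \<open>k\<close>-th circle. The image
  consists of the classes having a representative constant on all but finitely many circles.\<close>

definition weak_fundamental_product :: "'a topology \<Rightarrow> 'a \<Rightarrow> (nat \<Rightarrow> (real \<Rightarrow> 'a) set) monoid" where
  "weak_fundamental_product X x = sum_group {1..} (\<lambda>k. fundamental_group X x)"

definition weak_embedding ::
    "'a topology \<Rightarrow> 'a \<Rightarrow> (nat \<Rightarrow> (real \<Rightarrow> 'a) set) \<Rightarrow> (real \<times> real \<Rightarrow> 'a) set" where
  "weak_embedding X x n =
     hawaiian_homotopic X x `` {f \<in> hawaiian_maps X x.
       finite {k \<in> {1..}. \<exists>t\<in>{0..1}. f (he_circle k t) \<noteq> x} \<and>
       (\<forall>k\<in>{1..}. f \<circ> he_circle k \<in> n k)}"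

lemma he_circle_image:
  assumes "k \<ge> 1"
  shows "he_circle k ` {0..1} = {(a, b). (a - 1 / k)\<^sup>2 + b\<^sup>2 = (1 / k)\<^sup>2}"
proof (intro equalityI subsetI)
  fix z assume "z \<in> he_circle k ` {0..1}"
  then obtain t where z: "z = he_circle k t" by auto
  have "((1 - cos (2 * pi * t)) / k - 1 / k)\<^sup>2 + (sin (2 * pi * t) / k)\<^sup>2
      = ((cos (2 * pi * t))\<^sup>2 + (sin (2 * pi * t))\<^sup>2) / (real k)\<^sup>2"
    by (simp add: diff_divide_distrib power_divide flip: add_divide_distrib)
  then show "z \<in> {(a, b). (a - 1 / k)\<^sup>2 + b\<^sup>2 = (1 / k)\<^sup>2}"
    by (simp add: z he_circle_def power_divide)
next
  fix z assume "z \<in> {(a, b). (a - 1 / real k)\<^sup>2 + b\<^sup>2 = (1 / k)\<^sup>2}"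
  then obtain a b where z: "z = (a, b)" and ab: "(a - 1 / k)\<^sup>2 + b\<^sup>2 = (1 / k)\<^sup>2" by auto
  have "(1 - k * a)\<^sup>2 + (k * b)\<^sup>2 = (real k)\<^sup>2 * ((a - 1 / k)\<^sup>2 + b\<^sup>2)"
    using assms by (simp add: power2_eq_square field_simps)
  also have "\<dots> = 1"
    using assms by (simp add: ab power_divide)
  finally obtain s where s: "0 \<le> s" "s < 2 * pi" "1 - k * a = cos s" "k * b = sin s"
    using sincos_total_2pi by metis
  have "he_circle k (s / (2 * pi)) = z"
    using s assms by (simp add: he_circle_def z field_simps)
  moreover have "s / (2 * pi) \<in> {0..1}"
    using s by (simp add: field_simps)
  ultimately show "z \<in> he_circle k ` {0..1}" by blast
qed

lemma hawaiian_earring_eq: "hawaiian_earring = (\<Union>k\<in>{1..}. he_circle k ` {0..1})"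
  by (auto simp: hawaiian_earring_def he_circle_image simp del: image_iff)

lemma cos_2pi_eq_1:
  assumes "t \<in> {0..1}" "cos (2 * pi * t) = 1"
  shows "t = 0 \<or> t = 1"
proof -
  obtain m :: int where "2 * pi * t = of_int m * (2 * pi)"
    using assms(2) by (auto simp: cos_one_2pi_int)
  then have "t = of_int m" by simp
  with assms(1) show ?thesis by auto
qed

lemma he_concat_circle:
  assumes f: "f (0, 0) = x" and g: "g (0, 0) = x" and k: "k \<ge> 1" and t: "t \<in> {0..1}"
  shows "he_concat f g (he_circle k t) = loop_concat (f \<circ> he_circle k) (g \<circ> he_circle k) t"
proof -
  obtain l s where ls: "he_coords (he_circle k t) = (l, s)" by fastforce
  have "case he_coords (he_circle k t) of (l, s) \<Rightarrow>
      l \<ge> 1 \<and> s \<in> {0..1} \<and> he_circle l s = he_circle k t"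
    unfolding he_coords_def by (rule someI[where x = "(k, t)"]) (use k t in auto)
  with ls have l: "l \<ge> 1" and s: "s \<in> {0..1}" and eq: "he_circle l s = he_circle k t" by auto
  have ends: "loop_concat (f \<circ> he_circle i) (g \<circ> he_circle i) r = x" if "r = 0 \<or> r = 1" for i r
    using that f g by (auto simp: loop_concat_def he_circle_def)
  have goal: "loop_concat (f \<circ> he_circle l) (g \<circ> he_circle l) s
      = loop_concat (f \<circ> he_circle k) (g \<circ> he_circle k) t"
  proof (cases "cos (2 * pi * t) = 1")
    case True
    then have "cos (2 * pi * s) = 1"
      using eq l by (simp add: he_circle_def)
    then show ?thesis
      using ends cos_2pi_eq_1[OF t True] cos_2pi_eq_1[OF s] by metis
  next
    case False
    have norm: "(fst (he_circle i r))\<^sup>2 + (snd (he_circle i r))\<^sup>2 = 2 * fst (he_circle i r) / i"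
      if "i \<ge> 1" for i r
    proof -
      have "(sin (2 * pi * r))\<^sup>2 = 1 - (cos (2 * pi * r))\<^sup>2" by (simp add: sin_squared_eq)
      then show ?thesis
        using that by (simp add: he_circle_def power_divide field_simps power2_eq_square)
    qed
    have "fst (he_circle k t) \<noteq> 0" using False k by (simp add: he_circle_def)
    then have lk: "l = k"
      using norm[OF k, of t] norm[OF l, of s] k l unfolding eq by (simp add: field_simps)
    with eq k have "cos (2 * pi * s) = cos (2 * pi * t)" "sin (2 * pi * s) = sin (2 * pi * t)"
      by (simp_all add: he_circle_def)
    then obtain m :: int where "2 * pi * s = 2 * pi * t + 2 * pi * of_int m"
      by (metis sin_cos_eq_iff)
    then have "2 * pi * s = 2 * pi * (t + of_int m)" by (simp add: algebra_simps)
    then have m: "s = t + of_int m" by simp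
    have "t \<noteq> 0" "t \<noteq> 1" using False by auto
    then have "0 < t" "t < 1" using t by auto
    then have "m = 0" using m s by auto
    with m lk show ?thesis by simp
  qed
  show ?thesis by (simp add: he_concat_def ls goal)
qed


section \<open>Semidirect products\<close>

text \<open>For groups \<open>H\<close>, \<open>N\<close> and a homomorphism \<open>\<phi>\<close> from \<open>H\<close> to the automorphism group of \<open>N\<close>.\<close>

definition semidirect_product ::
    "('a, 'c) monoid_scheme \<Rightarrow> ('a \<Rightarrow> 'b \<Rightarrow> 'b) \<Rightarrow> ('b, 'd) monoid_scheme \<Rightarrow> ('a \<times> 'b) monoid" where
  "semidirect_product H \<phi> N =
     \<lparr>carrier = carrier H \<times> carrier N,
      mult = (\<lambda>(h, n) (h', n'). (h \<otimes>\<^bsub>H\<^esub> h', n \<otimes>\<^bsub>N\<^esub> \<phi> h n')),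
      one = (\<one>\<^bsub>H\<^esub>, \<one>\<^bsub>N\<^esub>)\<rparr>"

end

theory Submission
  imports Defs
begin

text \<open>
  A map on the earring is a sequence of loops that shrinks to the base point. Homotopies are
  sequences of loop homotopies that shrink in the same sense. So every statement about the Hawaiian
  group follows from statements about fundamental groups of subspaces, applied circle by circle
  with control sets that converge to the base point.

  Let \<open>V\<close> be an open neighbourhood of the base point in which all loops contract in \<open>X\<close>. A map \<open>f\<close>
  sends all but finitely many circles into \<open>V\<close>, so \<open>f\<close> is homotopic to a product of a map
  supported on finitely many circles and a map into \<open>V\<close>. If a map is homotopic to maps of both
  kinds, then all its loops contract, and only finitely many contractions are needed, so they fit
  together. The maps supported on finitely many circles form a normal subgroup up to homotopy,
  because on the other circles a conjugate \<open>g * c * g\<^sup>-\<^sup>1\<close> of the constant loop \<open>c\<close> contracts within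
  the image of \<open>g\<close>. Since \<open>V\<close> is open, it is itself the wedge of its traces on the two summands.
\<close>

section \<open>Quotient groups and internal semidirect products\<close>

text \<open>Contracting each loop of a map on the earring is weaker than contracting the map,
  because the contractions must also shrink to the base point. A loop in \<open>V\<close> contracts
  in \<open>X\<close>, but possibly only through large homotopies; a map into \<open>V\<close> thus
  has trivial loop classes and may still represent a nontrivial element. So these maps cannot be
  discarded and form the second factor.

  The obstacle is therefore continuity at the origin. Each homotopy of a \<open>k\<close>-th loop is
  placed in a subspace \<open>subtopology X (S k)\<close>, and \<open>null_family\<close> demands
  that every neighbourhood of the base point contain all but finitely many \<open>S k\<close>. Such
  families may be united and may be changed at finitely many indices, which is all that the group
  laws and the splitting require. For this reason the lemmas on loops are stated in an arbitrary
  space \<open>Y\<close>: they are later applied in the control subspaces.\<close>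

lemma quotient_group:
  assumes eq: "equiv M R"
    and cl: "\<And>p q. p \<in> M \<Longrightarrow> q \<in> M \<Longrightarrow> c p q \<in> M"
    and cong: "\<And>p p' q q'. (p, p') \<in> R \<Longrightarrow> (q, q') \<in> R \<Longrightarrow> (c p q, c p' q') \<in> R"
    and e: "e \<in> M"
    and assoc: "\<And>p q r. p \<in> M \<Longrightarrow> q \<in> M \<Longrightarrow> r \<in> M \<Longrightarrow> (c (c p q) r, c p (c q r)) \<in> R"
    and unit: "\<And>p. p \<in> M \<Longrightarrow> (c e p, p) \<in> R"
    and inv: "\<And>p. p \<in> M \<Longrightarrow> \<exists>q\<in>M. (c q p, e) \<in> R"
    and G: "G = \<lparr>carrier = M // R, mult = (\<lambda>A B. \<Union>p\<in>A. \<Union>q\<in>B. R `` {c p q}), one = R `` {e}\<rparr>"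
  shows "group G"
    and "\<And>p q. p \<in> M \<Longrightarrow> q \<in> M \<Longrightarrow> R `` {p} \<otimes>\<^bsub>G\<^esub> R `` {q} = R `` {c p q}"
proof -
  have "congruent2 R R (\<lambda>p q. R `` {c p q})"
    by (rule congruent2I') (meson cong eq equiv_class_eq)
  then show *: "R `` {p} \<otimes>\<^bsub>G\<^esub> R `` {q} = R `` {c p q}" if "p \<in> M" "q \<in> M" for p q
    using that by (simp add: G UN_equiv_class2 [OF eq eq])
  have [simp]: "carrier G = M // R" "\<one>\<^bsub>G\<^esub> = R `` {e}"
    by (simp_all add: G)
  have "R `` {c (c p q) r} = R `` {c p (c q r)}" "R `` {c e p} = R `` {p}"
    if "p \<in> M" "q \<in> M" "r \<in> M" for p q r
    using that by (simp_all add: equiv_class_eq [OF eq] assoc unit)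
  then show "group G"
  proof (intro groupI)
    fix a assume "a \<in> carrier G"
    then obtain p where p: "p \<in> M" "a = R `` {p}"
      by (auto elim: quotientE)
    then obtain q where "q \<in> M" "(c q p, e) \<in> R"
      using inv by blast
    moreover from this have "R `` {c q p} = R `` {e}"
      by (intro equiv_class_eq [OF eq])
    ultimately show "\<exists>b\<in>carrier G. b \<otimes>\<^bsub>G\<^esub> a = \<one>\<^bsub>G\<^esub>"
      using p by (intro bexI [of _ "R `` {q}"]) (simp_all add: * quotientI)
  qed (auto elim!: quotientE simp: * cl e quotientI)
qed

text \<open>The normal factor enters through an embedding \<open>e\<close>, since the weak product
  consists of tuples and is not a subset of \<open>G\<close>. Normality and injectivity of
  \<open>e\<close> pull conjugation back to automorphisms of \<open>N\<close>;
  \<open>trivial\<close> and \<open>gen\<close> make \<open>K\<close> a complement of the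
  image.\<close>

lemma internal_semidirect_product:
  assumes G: "group G" and N: "group N" and e: "e \<in> hom N G"
    and inj: "inj_on e (carrier N)"
    and normal: "\<And>g n. g \<in> carrier G \<Longrightarrow> n \<in> carrier N \<Longrightarrow>
                   g \<otimes>\<^bsub>G\<^esub> e n \<otimes>\<^bsub>G\<^esub> inv\<^bsub>G\<^esub> g \<in> e ` carrier N"
    and K: "subgroup K G"
    and trivial: "\<And>n. n \<in> carrier N \<Longrightarrow> e n \<in> K \<Longrightarrow> n = \<one>\<^bsub>N\<^esub>"
    and gen: "\<And>g. g \<in> carrier G \<Longrightarrow> \<exists>n\<in>carrier N. \<exists>k\<in>K. g = e n \<otimes>\<^bsub>G\<^esub> k"
  shows "\<exists>\<phi>\<in>hom (G\<lparr>carrier := K\<rparr>) (AutoGroup N).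
           (\<lambda>(h, n). e n \<otimes>\<^bsub>G\<^esub> h) \<in> iso (semidirect_product (G\<lparr>carrier := K\<rparr>) \<phi> N) G"
proof -
  interpret G: group G by fact
  interpret N: group N by fact
  interpret K: subgroup K G by fact
  interpret e: group_hom N G e
    by unfold_locales (rule e)
  \<comment> \<open>\<open>AutoGroup N\<close> consists of extensional functions, hence the
    restriction to \<open>carrier N\<close>.\<close>
  define \<phi> where
    "\<phi> g = (\<lambda>n\<in>carrier N. inv_into (carrier N) e (g \<otimes>\<^bsub>G\<^esub> e n \<otimes>\<^bsub>G\<^esub> inv\<^bsub>G\<^esub> g))" for g
  have \<phi>_mem: "\<phi> g n \<in> carrier N" and e_\<phi>: "e (\<phi> g n) = g \<otimes>\<^bsub>G\<^esub> e n \<otimes>\<^bsub>G\<^esub> inv\<^bsub>G\<^esub> g"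
    if "g \<in> carrier G" "n \<in> carrier N" for g n
    using normal [OF that] that(2) by (simp_all add: \<phi>_def inv_into_into f_inv_into_f)
  have eI: "m = n" if "e m = e n" "m \<in> carrier N" "n \<in> carrier N" for m n
    using inj that by (meson inj_onD)
  have conj_mult: "(g \<otimes>\<^bsub>G\<^esub> a \<otimes>\<^bsub>G\<^esub> inv\<^bsub>G\<^esub> g) \<otimes>\<^bsub>G\<^esub> (g \<otimes>\<^bsub>G\<^esub> b \<otimes>\<^bsub>G\<^esub> inv\<^bsub>G\<^esub> g) = g \<otimes>\<^bsub>G\<^esub> (a \<otimes>\<^bsub>G\<^esub> b) \<otimes>\<^bsub>G\<^esub> inv\<^bsub>G\<^esub> g"
    if "g \<in> carrier G" "a \<in> carrier G" "b \<in> carrier G" for g a b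
    using that by (metis G.inv_closed G.inv_solve_left G.m_assoc G.m_closed)
  have \<phi>_mult: "\<phi> (g \<otimes>\<^bsub>G\<^esub> h) n = \<phi> g (\<phi> h n)"
    if "g \<in> carrier G" "h \<in> carrier G" "n \<in> carrier N" for g h n
    using that by (intro eI) (simp_all add: \<phi>_mem e_\<phi> G.inv_mult_group G.m_assoc)
  have \<phi>_one: "\<phi> \<one>\<^bsub>G\<^esub> n = n" if "n \<in> carrier N" for n
    using that by (intro eI) (simp_all add: \<phi>_mem e_\<phi>)
  have \<phi>_hom: "\<phi> g (m \<otimes>\<^bsub>N\<^esub> n) = \<phi> g m \<otimes>\<^bsub>N\<^esub> \<phi> g n"
    if "g \<in> carrier G" "m \<in> carrier N" "n \<in> carrier N" for g m n
    using that by (intro eI) (simp_all add: \<phi>_mem e_\<phi> conj_mult)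
  have \<phi>_ext: "\<phi> g \<in> extensional (carrier N)" for g
    by (simp add: \<phi>_def)
  have \<phi>_Bij: "\<phi> g \<in> Bij (carrier N)" if g: "g \<in> carrier G" for g
  proof -
    have "bij_betw (\<phi> g) (carrier N) (carrier N)"
      using g by (intro bij_betw_byWitness [where f' = "\<phi> (inv\<^bsub>G\<^esub> g)"])
        (auto simp: \<phi>_mem \<phi>_one simp flip: \<phi>_mult)
    then show ?thesis
      by (simp add: Bij_def \<phi>_ext)
  qed
  have \<phi>_auto: "\<phi> g \<in> auto N" if "g \<in> carrier G" for g
    using that by (simp add: auto_def \<phi>_Bij homI \<phi>_mem \<phi>_hom)
  have "\<phi> \<in> hom (G\<lparr>carrier := K\<rparr>) (AutoGroup N)"
  proof (rule homI)
    fix g h assume "g \<in> carrier (G\<lparr>carrier := K\<rparr>)" "h \<in> carrier (G\<lparr>carrier := K\<rparr>)"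
    then have "g \<in> carrier G" "h \<in> carrier G"
      by auto
    moreover from this have "\<phi> (g \<otimes>\<^bsub>G\<^esub> h) = compose (carrier N) (\<phi> g) (\<phi> h)"
      by (intro extensionalityI [of "\<phi> (g \<otimes>\<^bsub>G\<^esub> h)" "carrier N"])
        (auto simp: \<phi>_mult compose_def \<phi>_ext)
    ultimately show "\<phi> (g \<otimes>\<^bsub>G\<lparr>carrier := K\<rparr>\<^esub> h) = \<phi> g \<otimes>\<^bsub>AutoGroup N\<^esub> \<phi> h"
      by (simp add: AutoGroup_def BijGroup_def \<phi>_Bij)
  qed (auto simp: AutoGroup_def \<phi>_auto)
  moreover have "(\<lambda>(h, n). e n \<otimes>\<^bsub>G\<^esub> h) \<in> iso (semidirect_product (G\<lparr>carrier := K\<rparr>) \<phi> N) G"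
  proof (rule isoI)
    show "(\<lambda>(h, n). e n \<otimes>\<^bsub>G\<^esub> h) \<in> hom (semidirect_product (G\<lparr>carrier := K\<rparr>) \<phi> N) G"
    proof (rule homI)
      fix p q assume "p \<in> carrier (semidirect_product (G\<lparr>carrier := K\<rparr>) \<phi> N)"
        and "q \<in> carrier (semidirect_product (G\<lparr>carrier := K\<rparr>) \<phi> N)"
      then obtain h n h' n' where pq: "p = (h, n)" "q = (h', n')"
        and [simp]: "h \<in> carrier G" "h' \<in> carrier G" "n \<in> carrier N" "n' \<in> carrier N"
        by (auto simp: semidirect_product_def)
      \<comment> \<open>The conjugating inverse of \<open>h\<close> cancels the next
        \<open>h\<close>; this is what puts \<open>e n\<close> to the left of \<open>h\<close> in
        the isomorphism.\<close>
      have "e n \<otimes>\<^bsub>G\<^esub> (h \<otimes>\<^bsub>G\<^esub> e n' \<otimes>\<^bsub>G\<^esub> inv\<^bsub>G\<^esub> h) \<otimes>\<^bsub>G\<^esub> (h \<otimes>\<^bsub>G\<^esub> h') = e n \<otimes>\<^bsub>G\<^esub> h \<otimes>\<^bsub>G\<^esub> (e n' \<otimes>\<^bsub>G\<^esub> h')"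
        by (simp add: G.m_assoc G.inv_solve_left flip: G.m_assoc [of "inv\<^bsub>G\<^esub> h" h h'])
      then show "(case p \<otimes>\<^bsub>semidirect_product (G\<lparr>carrier := K\<rparr>) \<phi> N\<^esub> q of (h, n) \<Rightarrow> e n \<otimes>\<^bsub>G\<^esub> h) =
          (case p of (h, n) \<Rightarrow> e n \<otimes>\<^bsub>G\<^esub> h) \<otimes>\<^bsub>G\<^esub> (case q of (h, n) \<Rightarrow> e n \<otimes>\<^bsub>G\<^esub> h)"
        by (simp add: semidirect_product_def pq \<phi>_mem e_\<phi>)
    qed (auto simp: semidirect_product_def)
    show "bij_betw (\<lambda>(h, n). e n \<otimes>\<^bsub>G\<^esub> h) (carrier (semidirect_product (G\<lparr>carrier := K\<rparr>) \<phi> N)) (carrier G)"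
    proof (rule bij_betw_imageI)
      show "inj_on (\<lambda>(h, n). e n \<otimes>\<^bsub>G\<^esub> h) (carrier (semidirect_product (G\<lparr>carrier := K\<rparr>) \<phi> N))"
      proof (rule inj_onI, clarsimp simp: semidirect_product_def)
        fix h n h' n'
        assume *: "h \<in> K" "n \<in> carrier N" "h' \<in> K" "n' \<in> carrier N" "e n \<otimes>\<^bsub>G\<^esub> h = e n' \<otimes>\<^bsub>G\<^esub> h'"
        have "e (inv\<^bsub>N\<^esub> n' \<otimes>\<^bsub>N\<^esub> n) = h' \<otimes>\<^bsub>G\<^esub> inv\<^bsub>G\<^esub> h"
          using * by (simp add: G.inv_solve_right G.m_assoc) (simp flip: G.m_assoc)
        moreover have "\<dots> \<in> K"
          using * by simp
        ultimately have "inv\<^bsub>N\<^esub> n' \<otimes>\<^bsub>N\<^esub> n = \<one>\<^bsub>N\<^esub>"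
          using * by (intro trivial) auto
        then have "n = n'"
          using * by (metis N.inv_equality N.inv_inv N.inv_closed)
        with * show "h = h' \<and> n = n'"
          by simp
      qed
      show "(\<lambda>(h, n). e n \<otimes>\<^bsub>G\<^esub> h) ` carrier (semidirect_product (G\<lparr>carrier := K\<rparr>) \<phi> N) = carrier G"
        using gen by (fastforce simp: semidirect_product_def)
    qed
  qed
  ultimately show ?thesis
    by blast
qed

section \<open>Homotopy of loops\<close>

text \<open>The first coordinate of the square is the deformation parameter, the second runs along
  the loop. Only values on the square count, so paths matter only on the unit interval.\<close>

lemma loop_homotopic_iff:
  "(p, q) \<in> loop_homotopic (Y :: 'a topology) y \<longleftrightarrow>
     (\<exists>h::real \<times> real \<Rightarrow> 'a. continuous_map (top_of_set ({0..1} \<times> {0..1})) Y h \<and>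
        (\<forall>t\<in>{0..1}. h (0, t) = p t \<and> h (1, t) = q t) \<and> (\<forall>s\<in>{0..1}. h (s, 0) = y \<and> h (s, 1) = y))"
  unfolding loop_homotopic_def
  by (subst mem_Collect_eq, subst case_prod_conv, subst homotopic_with)
     (auto simp add: ball_conj_distrib simp flip: subtopology_Times intro!: ex_cong)

text \<open>With membership expressed as reflexivity, each congruence lemma for homotopies yields a
  closure lemma for loops as its diagonal case.\<close>

lemma loops_iff: "p \<in> loops Y y \<longleftrightarrow> (p, p) \<in> loop_homotopic Y y"
  by (auto simp: loops_def loop_homotopic_def pathin_def)

lemma equiv_loop_homotopic: "equiv (loops Y y) (loop_homotopic Y y)"
proof (rule equivI)
  show "loop_homotopic Y y \<subseteq> loops Y y \<times> loops Y y"
    by (auto simp: loops_def loop_homotopic_def pathin_def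
        dest: homotopic_with_imp_continuous_maps homotopic_with_imp_property)
  show "refl_on (loops Y y) (loop_homotopic Y y)"
    by (simp add: refl_on_def loops_iff)
  show "sym (loop_homotopic Y y)"
    by (auto simp: sym_def loop_homotopic_def homotopic_with_sym)
  show "trans (loop_homotopic Y y)"
    by (auto simp: trans_def loop_homotopic_def intro: homotopic_with_trans)
qed

lemma loop_homotopic_sym: "(p, q) \<in> loop_homotopic Y y \<Longrightarrow> (q, p) \<in> loop_homotopic Y y"
  and loop_homotopic_trans [trans]:
    "(p, q) \<in> loop_homotopic Y y \<Longrightarrow> (q, r) \<in> loop_homotopic Y y \<Longrightarrow> (p, r) \<in> loop_homotopic Y y"
  by (meson equiv_def equiv_loop_homotopic symD, meson equiv_def equiv_loop_homotopic transD)

lemma loop_homotopic_imp_loops: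
  assumes "(p, q) \<in> loop_homotopic Y y"
  shows "p \<in> loops Y y" "q \<in> loops Y y"
  using assms equiv_loop_homotopic [of Y y] by (auto simp: equiv_def refl_on_def)

lemma loops_const: "y \<in> topspace Y \<Longrightarrow> (\<lambda>t. y) \<in> loops Y y"
  by (simp add: loops_def pathin_def)

text \<open>Loops are functions on all of \<open>real\<close>, while glued maps are known only on
  the unit interval; this bridges the gap.\<close>

lemma loop_homotopic_equal:
  assumes "p \<in> loops Y y" "\<And>t. t \<in> {0..1} \<Longrightarrow> q t = p t"
  shows "(p, q) \<in> loop_homotopic Y y"
  using assms
  by (auto simp: loop_homotopic_def loops_def pathin_def intro!: homotopic_with_equal)

text \<open>Enlarging the control set allows homotopies with different controls to be combined in
  the union.\<close>

lemma loop_homotopic_mono: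
  assumes "(p, q) \<in> loop_homotopic (subtopology Y S) y" "S \<inter> topspace Y \<subseteq> T"
  shows "(p, q) \<in> loop_homotopic (subtopology Y T) y"
proof -
  have "continuous_map (subtopology Y S) (subtopology Y T) id"
    using assms(2) by (auto simp: continuous_map_in_subtopology continuous_map_id_subt)
  with assms(1) show ?thesis
    unfolding loop_homotopic_def
    by (auto dest: homotopic_with_compose_continuous_map_left
        [where h = id and q = "\<lambda>r. r 0 = y \<and> r 1 = y"])
qed

lemma loop_homotopic_subtopology:
  "(p, q) \<in> loop_homotopic (subtopology Y S) y \<Longrightarrow> (p, q) \<in> loop_homotopic Y y"
  using loop_homotopic_mono [of p q Y S y UNIV] by simp

lemma loops_mono: "p \<in> loops (subtopology Y S) y \<Longrightarrow> S \<inter> topspace Y \<subseteq> T \<Longrightarrow> p \<in> loops (subtopology Y T) y"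
  by (simp add: loops_iff loop_homotopic_mono)

lemma loop_concat_cong:
  assumes "(p, p') \<in> loop_homotopic Y y" "(q, q') \<in> loop_homotopic Y y"
  shows "(loop_concat p q, loop_concat p' q') \<in> loop_homotopic Y y"
proof -
  let ?I = "{0..1::real}"
  obtain g h where g: "continuous_map (top_of_set (?I \<times> ?I)) Y g"
      "\<And>t. t \<in> ?I \<Longrightarrow> g (0, t) = p t" "\<And>t. t \<in> ?I \<Longrightarrow> g (1, t) = p' t"
      "\<And>s. s \<in> ?I \<Longrightarrow> g (s, 0) = y" "\<And>s. s \<in> ?I \<Longrightarrow> g (s, 1) = y"
    and h: "continuous_map (top_of_set (?I \<times> ?I)) Y h"
      "\<And>t. t \<in> ?I \<Longrightarrow> h (0, t) = q t" "\<And>t. t \<in> ?I \<Longrightarrow> h (1, t) = q' t"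
      "\<And>s. s \<in> ?I \<Longrightarrow> h (s, 0) = y" "\<And>s. s \<in> ?I \<Longrightarrow> h (s, 1) = y"
    using assms unfolding loop_homotopic_iff by blast
  define k where "k z = (if snd z \<le> 1/2 then (g \<circ> (\<lambda>z. (fst z, 2 * snd z))) z
    else (h \<circ> (\<lambda>z. (fst z, 2 * snd z - 1))) z)" for z
  have "continuous_map (top_of_set (?I \<times> ?I)) Y k"
    unfolding k_def
  proof (rule continuous_map_cases_le)
    show "continuous_map (subtopology (top_of_set (?I \<times> ?I)) {z \<in> topspace (top_of_set (?I \<times> ?I)). snd z \<le> 1/2})
        Y (g \<circ> (\<lambda>z. (fst z, 2 * snd z)))"
      unfolding subtopology_subtopology
      by (rule continuous_map_compose [OF _ g(1)]) (auto intro!: continuous_intros)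
    show "continuous_map (subtopology (top_of_set (?I \<times> ?I)) {z \<in> topspace (top_of_set (?I \<times> ?I)). 1/2 \<le> snd z})
        Y (h \<circ> (\<lambda>z. (fst z, 2 * snd z - 1)))"
      unfolding subtopology_subtopology
      by (rule continuous_map_compose [OF _ h(1)]) (auto intro!: continuous_intros)
    fix z assume z: "z \<in> topspace (top_of_set (?I \<times> ?I))" and half: "snd z = 1/2"
    have "(g \<circ> (\<lambda>z. (fst z, 2 * snd z))) z = y" "(h \<circ> (\<lambda>z. (fst z, 2 * snd z - 1))) z = y"
      unfolding o_def half using z by (auto simp: g h)
    then show "(g \<circ> (\<lambda>z. (fst z, 2 * snd z))) z = (h \<circ> (\<lambda>z. (fst z, 2 * snd z - 1))) z"
      by simp
  qed (auto intro!: continuous_intros)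
  then show ?thesis
    unfolding loop_homotopic_iff
    by (intro exI [of _ k]) (auto simp: k_def loop_concat_def g h)
qed

lemma loops_concat: "p \<in> loops Y y \<Longrightarrow> q \<in> loops Y y \<Longrightarrow> loop_concat p q \<in> loops Y y"
  by (simp add: loops_iff loop_concat_cong)

section \<open>Group laws for loops by reparametrization\<close>

text \<open>The interval is convex, so two parametrizations with equal ends are joined by straight
  lines. The homotopy factors through \<open>p\<close> and never leaves its image. Associativity,
  the unit laws and the inverse laws are all of this form.\<close>

lemma loop_homotopic_reparametrize:
  assumes p: "pathin Y p"
    and a: "continuous_on {0..1} a" "a \<in> {0..1} \<rightarrow> {0..1::real}"
    and b: "continuous_on {0..1} b" "b \<in> {0..1} \<rightarrow> {0..1::real}"
    and ends: "a 0 = b 0" "a 1 = b 1" "p (a 0) = y" "p (a 1) = y"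
    and eq: "\<And>t. t \<in> {0..1} \<Longrightarrow> p' t = p (a t)" "\<And>t. t \<in> {0..1} \<Longrightarrow> q' t = p (b t)"
  shows "(p', q') \<in> loop_homotopic Y y"
proof -
  let ?I = "{0..1::real}" and ?l = "\<lambda>z. (1 - fst z) * a (snd z) + fst z * b (snd z)"
  have "?l z \<in> ?I" if "z \<in> ?I \<times> ?I" for z
  proof -
    have "a (snd z) \<in> ?I" "b (snd z) \<in> ?I" "fst z \<in> ?I"
      using that a b by (auto simp: Pi_iff)
    then show ?thesis
      using convexD [of ?I "a (snd z)" "b (snd z)" "1 - fst z" "fst z"] by auto
  qed
  moreover have "continuous_on (?I \<times> ?I) ?l"
    by (intro continuous_intros continuous_on_compose2 [OF a(1)] continuous_on_compose2 [OF b(1)]) auto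
  ultimately have "continuous_map (top_of_set (?I \<times> ?I)) Y (p \<circ> ?l)"
    using p unfolding pathin_def by (intro continuous_map_compose [where X' = "top_of_set ?I"]) auto
  then show ?thesis
    unfolding loop_homotopic_iff
    by (intro exI [of _ "p \<circ> ?l"]) (auto simp: eq ends ends(3,4) [unfolded ends(1,2)] left_diff_distrib)
qed

lemma continuous_on_if_le:
  fixes f g :: "real \<Rightarrow> real"
  assumes "continuous_on UNIV f" "continuous_on UNIV g" "f c = g c"
  shows "continuous_on S (\<lambda>t. if t \<le> c then f t else g t)"
proof -
  have "continuous_on ({..c} \<union> {c..}) (\<lambda>t. if t \<le> c then f t else g t)"
    by (rule continuous_on_cases) (use assms in \<open>auto intro: continuous_on_subset\<close>)
  moreover have "{..c} \<union> {c..} = UNIV" by auto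
  ultimately show ?thesis
    by (metis continuous_on_subset subset_UNIV)
qed

lemma loop_concat_assoc:
  assumes "p \<in> loops Y y" "q \<in> loops Y y" "r \<in> loops Y y"
  shows "(loop_concat (loop_concat p q) r, loop_concat p (loop_concat q r)) \<in> loop_homotopic Y y"
proof -
  \<comment> \<open>The left-nested product changes loops at \<open>1/4\<close> and
    \<open>1/2\<close>, the right-nested one at \<open>1/2\<close> and \<open>3/4\<close>;
    \<open>?b\<close> is the piecewise linear map taking the latter breakpoints to the
    former.\<close>
  let ?b = "\<lambda>t::real. if t \<le> 1/2 then t / 2 else if t \<le> 3/4 then t - 1/4 else 2 * t - 1"
  have l: "loop_concat (loop_concat p q) r \<in> loops Y y"
    using assms by (simp add: loops_concat)
  show ?thesis
  proof (rule loop_homotopic_reparametrize [where p = "loop_concat (loop_concat p q) r" and a = "\<lambda>t. t" and b = ?b])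
    show "continuous_on {0..1} ?b"
      by (intro continuous_on_if_le continuous_intros) auto
    show "loop_concat p (loop_concat q r) t = loop_concat (loop_concat p q) r (?b t)" if "t \<in> {0..1}" for t
      using that assms by (auto simp: loop_concat_def loops_def algebra_simps diff_divide_distrib add_divide_distrib)
  qed (use l in \<open>auto simp: loops_def\<close>)
qed

lemma loop_concat_const_left:
  assumes "p \<in> loops Y y"
  shows "(loop_concat (\<lambda>t. y) p, p) \<in> loop_homotopic Y y"
proof (rule loop_homotopic_reparametrize [where p = p and a = "\<lambda>t. max 0 (2 * t - 1)" and b = "\<lambda>t. t"])
  show "continuous_on {0..1} (\<lambda>t::real. max 0 (2 * t - 1))"
    by (intro continuous_intros)
  show "loop_concat (\<lambda>t. y) p t = p (max 0 (2 * t - 1))" if "t \<in> {0..1}" for t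
  proof (cases "t = 1/2")
    case True
    show ?thesis
      unfolding True using assms by (simp add: loops_def loop_concat_def)
  qed (use assms in \<open>auto simp: loops_def loop_concat_def max_def\<close>)
qed (use assms in \<open>auto simp: loops_def\<close>)

lemma loop_concat_const_right:
  assumes "p \<in> loops Y y"
  shows "(loop_concat p (\<lambda>t. y), p) \<in> loop_homotopic Y y"
proof (rule loop_homotopic_reparametrize [where p = p and a = "\<lambda>t. min 1 (2 * t)" and b = "\<lambda>t. t"])
  show "continuous_on {0..1} (\<lambda>t::real. min 1 (2 * t))"
    by (intro continuous_intros)
  show "loop_concat p (\<lambda>t. y) t = p (min 1 (2 * t))" if "t \<in> {0..1}" for t
  proof (cases "t = 1/2")
    case True
    show ?thesis
      unfolding True using assms by (simp add: loops_def loop_concat_def)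
  qed (use assms in \<open>auto simp: loops_def loop_concat_def min_def\<close>)
qed (use assms in \<open>auto simp: loops_def\<close>)

definition loop_reverse :: "(real \<Rightarrow> 'a) \<Rightarrow> real \<Rightarrow> 'a" where
  "loop_reverse p t = p (1 - t)"

text \<open>Using one parametrization twice turns the homotopy lemma into a proof that the composite
  is a loop.\<close>

lemma loops_reverse:
  assumes "p \<in> loops Y y"
  shows "loop_reverse p \<in> loops Y y"
  unfolding loops_iff
  by (rule loop_homotopic_reparametrize [where p = p and a = "\<lambda>t. 1 - t" and b = "\<lambda>t. 1 - t"])
     (use assms in \<open>auto simp: loops_def loop_reverse_def intro!: continuous_intros\<close>)

lemma loop_concat_reverse_left:
  assumes "p \<in> loops Y y"
  shows "(loop_concat (loop_reverse p) p, \<lambda>t. y) \<in> loop_homotopic Y y"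
\<comment> \<open>The product runs through \<open>p\<close> from \<open>1\<close> to
  \<open>0\<close> and back. The constant parametrization is \<open>1\<close> and not
  \<open>0\<close>, as the ends of both must agree.\<close>
proof (rule loop_homotopic_reparametrize [where p = p and a = "\<lambda>t. \<bar>1 - 2 * t\<bar>" and b = "\<lambda>t. 1"])
  show "continuous_on {0..1} (\<lambda>t::real. \<bar>1 - 2 * t\<bar>)"
    by (intro continuous_intros)
qed (use assms in \<open>auto simp: loops_def loop_reverse_def loop_concat_def abs_if\<close>)

lemma loop_concat_reverse_right:
  assumes "p \<in> loops Y y"
  shows "(loop_concat p (loop_reverse p), \<lambda>t. y) \<in> loop_homotopic Y y"
proof -
  have "loop_reverse (loop_reverse p) = p"
    by (simp add: loop_reverse_def fun_eq_iff)
  then show ?thesis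
    using loop_concat_reverse_left [OF loops_reverse [OF assms]] by simp
qed

lemma
  assumes "y \<in> topspace Y"
  shows group_fundamental_group: "group (fundamental_group Y y)"
    and mult_fundamental_group: "p \<in> loops Y y \<Longrightarrow> q \<in> loops Y y \<Longrightarrow>
      loop_homotopic Y y `` {p} \<otimes>\<^bsub>fundamental_group Y y\<^esub> loop_homotopic Y y `` {q} =
      loop_homotopic Y y `` {loop_concat p q}"
proof -
  have inv: "\<exists>q\<in>loops Y y. (loop_concat q p, \<lambda>t. y) \<in> loop_homotopic Y y" if "p \<in> loops Y y" for p
    by (intro bexI [of _ "loop_reverse p"] loop_concat_reverse_left loops_reverse that)
  note * = quotient_group [where c = loop_concat, OF equiv_loop_homotopic loops_concat loop_concat_cong
    loops_const [OF assms] loop_concat_assoc loop_concat_const_left inv fundamental_group_def]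
  show "group (fundamental_group Y y)"
    by (rule *(1))
  show "p \<in> loops Y y \<Longrightarrow> q \<in> loops Y y \<Longrightarrow>
      loop_homotopic Y y `` {p} \<otimes>\<^bsub>fundamental_group Y y\<^esub> loop_homotopic Y y `` {q} =
      loop_homotopic Y y `` {loop_concat p q}"
    by (rule *(2))
qed

lemma carrier_fundamental_group: "carrier (fundamental_group Y y) = loops Y y // loop_homotopic Y y"
  and one_fundamental_group: "\<one>\<^bsub>fundamental_group Y y\<^esub> = loop_homotopic Y y `` {\<lambda>t. y}"
  by (simp_all add: fundamental_group_def)

section \<open>Maps on the earring as null sequences of loops\<close>

text \<open>Convergence of the sets \<open>S k\<close> to \<open>x\<close>, which encodes continuity
  at the origin. Index \<open>0\<close> belongs to no circle of the earring and is harmless, since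
  only finiteness counts.\<close>

definition null_family :: "'a topology \<Rightarrow> 'a \<Rightarrow> (nat \<Rightarrow> 'a set) \<Rightarrow> bool" where
  "null_family X x S \<longleftrightarrow> (\<forall>V. openin X V \<and> x \<in> V \<longrightarrow> finite {k. \<not> S k \<subseteq> V})"

lemma null_family_Un:
  assumes "null_family X x S" "null_family X x T"
  shows "null_family X x (\<lambda>k. S k \<union> T k)"
  unfolding null_family_def
proof clarify
  fix V assume "openin X V" "x \<in> V"
  then have "finite ({k. \<not> S k \<subseteq> V} \<union> {k. \<not> T k \<subseteq> V})"
    using assms by (simp add: null_family_def)
  then show "finite {k. \<not> S k \<union> T k \<subseteq> V}"
    by (rule rev_finite_subset) auto
qed

text \<open>Finitely many control sets may be replaced by anything, even by the whole space. This is
  what permits finitely many loops to be deformed without control.\<close>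

lemma null_family_modify:
  assumes S: "null_family X x S" and F: "finite F" and "\<And>k. k \<notin> F \<Longrightarrow> T k \<subseteq> insert x (S k)"
  shows "null_family X x T"
  unfolding null_family_def
proof clarify
  fix V assume "openin X V" "x \<in> V"
  then have "finite (F \<union> {k. \<not> S k \<subseteq> V})"
    using S F by (simp add: null_family_def)
  then show "finite {k. \<not> T k \<subseteq> V}"
    by (rule rev_finite_subset) (use assms(3) \<open>x \<in> V\<close> in blast)
qed

text \<open>Away from the origin the chosen coordinates are the only ones. At the origin the circle
  is arbitrary, but both parameters are endpoints, where all glued loops agree.\<close>

lemma he_coords_circle:
  assumes k: "k \<ge> 1" and t: "t \<in> {0..1}" and ls: "he_coords (he_circle k t) = (l, s)"
  shows "l \<ge> 1" "(l, s) = (k, t) \<or> t \<in> {0, 1} \<and> s \<in> {0, 1}"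
proof -
  have "case he_coords (he_circle k t) of (l, s) \<Rightarrow>
      l \<ge> 1 \<and> s \<in> {0..1} \<and> he_circle l s = he_circle k t"
    unfolding he_coords_def by (rule someI [where x = "(k, t)"]) (use k t in auto)
  with ls have l: "l \<ge> 1" and s: "s \<in> {0..1}" and eq: "he_circle l s = he_circle k t"
    by auto
  show "l \<ge> 1" by fact
  show "(l, s) = (k, t) \<or> t \<in> {0, 1} \<and> s \<in> {0, 1}"
  proof (cases "cos (2 * pi * t) = 1")
    case True
    moreover from this have "cos (2 * pi * s) = 1"
      using eq l by (simp add: he_circle_def)
    ultimately show ?thesis
      using cos_2pi_eq_1 [OF t] cos_2pi_eq_1 [OF s] by simp
  next
    case False
    \<comment> \<open>Off the origin, this equation of the circle recovers the index
      \<open>i\<close> from the point.\<close>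
    have norm: "(fst (he_circle i r))\<^sup>2 + (snd (he_circle i r))\<^sup>2 = 2 * fst (he_circle i r) / i"
      if "i \<ge> 1" for i r
    proof -
      have "(sin (2 * pi * r))\<^sup>2 = 1 - (cos (2 * pi * r))\<^sup>2"
        by (simp add: sin_squared_eq)
      then show ?thesis
        using that by (simp add: he_circle_def power_divide field_simps power2_eq_square)
    qed
    have "fst (he_circle k t) \<noteq> 0"
      using False k by (simp add: he_circle_def)
    then have "l = k"
      using norm [OF k, of t] norm [OF l, of s] k l unfolding eq by (simp add: field_simps)
    with eq k have "cos (2 * pi * s) = cos (2 * pi * t)" "sin (2 * pi * s) = sin (2 * pi * t)"
      by (simp_all add: he_circle_def)
    then obtain m :: int where "2 * pi * s = 2 * pi * t + 2 * pi * of_int m"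
      by (metis sin_cos_eq_iff)
    then have "2 * pi * s = 2 * pi * (t + of_int m)"
      by (simp add: algebra_simps)
    then have m: "s = t + of_int m"
      by simp
    have "t \<noteq> 0" "t \<noteq> 1"
      using False by auto
    then have "m = 0"
      using m s t by auto
    with m \<open>l = k\<close> show ?thesis
      by simp
  qed
qed

text \<open>On the earring \<open>he_coords\<close> yields indices of at least \<open>1\<close>, so
  \<open>p 0\<close> is never consulted there. The result respects the given loops if they share
  their ends.\<close>

definition he_glue :: "(nat \<Rightarrow> real \<Rightarrow> 'a) \<Rightarrow> real \<times> real \<Rightarrow> 'a" where
  "he_glue p z = (case he_coords z of (k, t) \<Rightarrow> p k t)"

lemma he_glue_circle:
  assumes "\<And>j. j \<ge> 1 \<Longrightarrow> p j 0 = x \<and> p j 1 = x" "k \<ge> 1" "t \<in> {0..1}"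
  shows "he_glue p (he_circle k t) = p k t"
proof -
  obtain l s where ls: "he_coords (he_circle k t) = (l, s)"
    by fastforce
  show ?thesis
    using he_coords_circle [OF assms(2,3) ls] assms by (auto simp: he_glue_def ls)
qed

lemma he_circle_ends [simp]: "he_circle k 0 = (0, 0)" "he_circle k 1 = (0, 0)"
  by (simp_all add: he_circle_def)

lemma he_circle_in_earring: "k \<ge> 1 \<Longrightarrow> t \<in> {0..1} \<Longrightarrow> he_circle k t \<in> hawaiian_earring"
  unfolding hawaiian_earring_eq by blast

lemma origin_in_earring: "(0, 0) \<in> hawaiian_earring"
  using he_circle_in_earring [of 1 0] by simp

definition recip_nats :: "real set" where
  "recip_nats = range (\<lambda>k. 1 / real k)"

text \<open>Since \<open>1 / 0 = 0\<close>, the circle with index \<open>0\<close> is the origin. So the earring, times the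
  interval of homotopy parameters, is a quotient of a compact space in which the circles are
  separated: the limit circle at \<open>0 \<in> recip_nats\<close> is collapsed to the origin.\<close>

definition he_param :: "real \<times> real \<times> real \<Rightarrow> real \<times> real \<times> real" where
  "he_param = (\<lambda>(s, u, t). (s, u * (1 - cos (2 * pi * t)), u * sin (2 * pi * t)))"

lemma he_param_circle: "he_param (s, 1 / real k, t) = (s, he_circle k t)"
  by (simp add: he_param_def he_circle_def)

lemma he_param_0: "he_param (s, 0, t) = (s, 0, 0)"
  by (simp add: he_param_def)

lemma compact_recip_nats: "compact recip_nats"
proof -
  have "(\<lambda>k. 1 / real k) \<longlonglongrightarrow> 0"
    by (rule lim_1_over_n)
  then have "compact (insert 0 recip_nats)"
    unfolding recip_nats_def by (rule compact_sequence_with_limit)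
  moreover have "insert 0 recip_nats = recip_nats"
    by (auto simp: recip_nats_def image_iff intro: exI [of _ 0])
  ultimately show ?thesis by simp
qed

lemma he_param_image: "he_param ` ({0..1} \<times> recip_nats \<times> {0..1}) = {0..1} \<times> hawaiian_earring"
proof -
  have "he_circle k t \<in> hawaiian_earring" if "t \<in> {0..1}" for k t
    using that he_circle_in_earring [of k t] origin_in_earring
    by (cases "k = 0") (auto simp: he_circle_def)
  then have "he_param ` ({0..1} \<times> recip_nats \<times> {0..1}) \<subseteq> {0..1} \<times> hawaiian_earring"
    by (auto simp: recip_nats_def he_param_circle simp del: atLeastAtMost_iff)
  moreover have "(s, he_circle k t) \<in> he_param ` ({0..1} \<times> recip_nats \<times> {0..1})"
    if "s \<in> {0..1}" "t \<in> {0..1}" for s k t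
    using that by (intro image_eqI [of _ _ "(s, 1 / real k, t)"]) (auto simp: he_param_circle recip_nats_def)
  then have "{0..1} \<times> hawaiian_earring \<subseteq> he_param ` ({0..1} \<times> recip_nats \<times> {0..1})"
    unfolding hawaiian_earring_eq by auto
  ultimately show ?thesis by blast
qed

text \<open>A continuous map from a compact space onto a Hausdorff space is closed, hence a quotient
  map. Carrying the deformation parameter along in \<open>he_param\<close> avoids having to multiply
  a quotient map by the interval.\<close>

lemma quotient_map_he_param:
  "quotient_map (top_of_set ({0..1} \<times> recip_nats \<times> {0..1})) (top_of_set ({0..1} \<times> hawaiian_earring)) he_param"
proof -
  let ?D = "{0..1::real} \<times> recip_nats \<times> {0..1::real}"
  have cont: "continuous_on ?D he_param"
    unfolding he_param_def case_prod_unfold by (intro continuous_intros)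
  have "compact ?D"
    by (intro compact_Times compact_recip_nats compact_Icc)
  then have "closed_map (top_of_set ?D) (top_of_set ({0..1} \<times> hawaiian_earring)) he_param"
    using cont by (intro continuous_imp_closed_map)
      (auto simp: compact_space_subtopology compactin_euclidean_iff Hausdorff_space_subtopology he_param_image
        simp flip: he_param_image)
  with cont show ?thesis
    by (intro continuous_closed_imp_quotient_map) (auto simp flip: he_param_image)
qed

lemma hawaiian_homotopic_iff_param:
  "(f, g) \<in> hawaiian_homotopic X x \<longleftrightarrow>
     (\<exists>h. continuous_map (top_of_set ({0..1} \<times> recip_nats \<times> {0..1})) X (h \<circ> he_param) \<and>
        (\<forall>z\<in>hawaiian_earring. h (0, z) = f z \<and> h (1, z) = g z) \<and> (\<forall>s\<in>{0..1}. h (s, 0, 0) = x))"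
  unfolding hawaiian_homotopic_def continuous_compose_quotient_map_eq [OF quotient_map_he_param]
  by (subst mem_Collect_eq, subst case_prod_conv, subst homotopic_with)
     (auto simp: origin_in_earring ball_conj_distrib simp flip: subtopology_Times)

text \<open>The reason is compactness: the parameters sent outside an open \<open>V\<close> around
  \<open>x\<close> form a compact set whose middle coordinates avoid \<open>0\<close>. These
  coordinates stay away from \<open>0\<close>, so only finitely many \<open>1 / k\<close> occur
  among them.\<close>

lemma hawaiian_homotopic_imp_loop_homotopic:
  assumes "(f, g) \<in> hawaiian_homotopic X x"
  shows "\<exists>S. null_family X x S \<and>
    (\<forall>k\<ge>1. (f \<circ> he_circle k, g \<circ> he_circle k) \<in> loop_homotopic (subtopology X (S k)) x)"
proof -
  let ?I = "{0..1::real}" and ?D = "{0..1::real} \<times> recip_nats \<times> {0..1::real}"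
  obtain h where h: "continuous_map (top_of_set ?D) X (h \<circ> he_param)"
      "\<forall>z\<in>hawaiian_earring. h (0, z) = f z \<and> h (1, z) = g z" "\<forall>s\<in>?I. h (s, 0, 0) = x"
    using assms hawaiian_homotopic_iff_param by metis
  \<comment> \<open>The smallest possible control: exactly the points that the homotopy visits on
    the \<open>k\<close>-th circle.\<close>
  define S where "S k = (\<lambda>z. h (fst z, he_circle k (snd z))) ` (?I \<times> ?I)" for k
  have "finite {k. \<not> S k \<subseteq> V}" if V: "openin X V" "x \<in> V" for V
  proof -
    define C where "C = {d \<in> ?D. h (he_param d) \<notin> V}"
    have "closedin (top_of_set ?D) {d \<in> topspace (top_of_set ?D). (h \<circ> he_param) d \<in> topspace X - V}"
      by (rule closedin_continuous_map_preimage [OF h(1)]) (simp add: V closedin_diff)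
    moreover have "{d \<in> topspace (top_of_set ?D). (h \<circ> he_param) d \<in> topspace X - V} = C"
      using continuous_map_funspace [OF h(1)] by (auto simp: C_def Pi_iff)
    ultimately have "closedin (top_of_set ?D) C"
      by simp
    then have "compact C"
      by (rule closedin_compact [rotated]) (intro compact_Times compact_recip_nats compact_Icc)
    then have "compact ((fst \<circ> snd) ` C)"
      by (intro compact_continuous_image continuous_intros)
    then have "open (- (fst \<circ> snd) ` C)"
      by (simp add: compact_imp_closed open_Compl)
    moreover have "0 \<notin> (fst \<circ> snd) ` C"
      using h(3) V by (auto simp: C_def he_param_0)
    ultimately obtain e where "e > 0" and e: "ball 0 e \<subseteq> - (fst \<circ> snd) ` C"
      by (metis ComplI open_contains_ball)
    have "real k \<le> 1 / e" if "\<not> S k \<subseteq> V" for k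
    proof -
      obtain z where "z \<in> ?I \<times> ?I" "h (fst z, he_circle k (snd z)) \<notin> V"
        using \<open>\<not> S k \<subseteq> V\<close> unfolding S_def by blast
      then obtain s t where "s \<in> ?I" "t \<in> ?I" "h (s, he_circle k t) \<notin> V"
        by (cases z) auto
      then have "(s, 1 / real k, t) \<in> C"
        by (auto simp: C_def he_param_circle recip_nats_def)
      then have "1 / real k \<notin> ball 0 e"
        using e by force
      then show ?thesis
        using \<open>e > 0\<close> by (cases "k = 0") (auto simp: field_simps)
    qed
    then have "{k. \<not> S k \<subseteq> V} \<subseteq> {..nat \<lfloor>1 / e\<rfloor>}"
      using le_nat_floor by blast
    then show ?thesis
      using finite_subset by blast
  qed
  moreover have "(f \<circ> he_circle k, g \<circ> he_circle k) \<in> loop_homotopic (subtopology X (S k)) x"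
    if k: "k \<ge> 1" for k
    unfolding loop_homotopic_iff
  proof (intro exI conjI ballI)
    let ?h = "\<lambda>z. h (fst z, he_circle k (snd z))"
    have eq: "?h = (h \<circ> he_param) \<circ> (\<lambda>z. (fst z, 1 / real k, snd z))"
      by (simp add: fun_eq_iff he_param_circle)
    have "continuous_map (top_of_set (?I \<times> ?I)) (top_of_set ?D) (\<lambda>z. (fst z, 1 / real k, snd z))"
      by (auto simp: recip_nats_def intro!: continuous_intros)
    then have "continuous_map (top_of_set (?I \<times> ?I)) X ?h"
      unfolding eq by (rule continuous_map_compose [OF _ h(1)])
    then show "continuous_map (top_of_set (?I \<times> ?I)) (subtopology X (S k)) ?h"
      by (simp add: continuous_map_in_subtopology S_def)
  qed (use k h in \<open>auto simp: he_circle_in_earring\<close>)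
  ultimately show ?thesis
    by (auto simp: null_family_def intro: exI [of _ S])
qed

text \<open>Allows continuity at a point over \<open>1 / k\<close> to be checked on the
  \<open>k\<close>-th circle alone.\<close>

lemma recip_nats_isolated:
  assumes "k \<ge> 1"
  shows "\<exists>U. open U \<and> U \<inter> recip_nats = {1 / real k}"
proof (intro exI conjI)
  \<comment> \<open>The half-integers around \<open>k\<close> separate it from every other index.
    The left end is positive, which excludes index \<open>0\<close>.\<close>
  let ?U = "{1 / (real k + 1/2) <..< 1 / (real k - 1/2)}"
  show "open ?U"
    by simp
  have "j = k" if "1 / real j \<in> ?U" for j
  proof -
    have "0 < 1 / (real k + 1/2)"
      by simp
    with that have "0 < 1 / real j"
      by (metis greaterThanLessThan_iff less_trans)
    then have "j \<noteq> 0"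
      by (cases "j = 0") auto
    with that assms have "real k - 1/2 < real j" "real j < real k + 1/2"
      by (auto simp: field_simps)
    then show ?thesis
      by linarith
  qed
  moreover have "1 / real k \<in> ?U"
    using assms by (auto simp: field_simps)
  ultimately show "?U \<inter> recip_nats = {1 / real k}"
    by (auto simp: recip_nats_def)
qed

text \<open>The glued homotopy is tested on the compact parameter space. A circle with
  \<open>k \<ge> 1\<close> is isolated there, so its own homotopy suffices; near the limit circle
  the null family keeps all values in a given neighbourhood of \<open>x\<close>.\<close>

lemma loop_homotopic_imp_hawaiian_homotopic:
  assumes x: "x \<in> topspace X" and f: "f (0, 0) = x" and g: "g (0, 0) = x" and S: "null_family X x S"
    and hom: "\<And>k. k \<ge> 1 \<Longrightarrow> (f \<circ> he_circle k, g \<circ> he_circle k) \<in> loop_homotopic (subtopology X (S k)) x"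
  shows "(f, g) \<in> hawaiian_homotopic X x"
proof -
  let ?I = "{0..1::real}" and ?D = "{0..1::real} \<times> recip_nats \<times> {0..1::real}"
  have "\<forall>k. \<exists>h. k \<ge> 1 \<longrightarrow> continuous_map (top_of_set (?I \<times> ?I)) (subtopology X (S k)) h \<and>
        (\<forall>t\<in>?I. h (0, t) = f (he_circle k t) \<and> h (1, t) = g (he_circle k t)) \<and>
        (\<forall>s\<in>?I. h (s, 0) = x \<and> h (s, 1) = x)"
    using hom by (simp add: loop_homotopic_iff)
  then obtain H where "\<forall>k\<ge>1. continuous_map (top_of_set (?I \<times> ?I)) (subtopology X (S k)) (H k) \<and>
        (\<forall>t\<in>?I. H k (0, t) = f (he_circle k t) \<and> H k (1, t) = g (he_circle k t)) \<and>
        (\<forall>s\<in>?I. H k (s, 0) = x \<and> H k (s, 1) = x)"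
    by metis
  then have H: "continuous_map (top_of_set (?I \<times> ?I)) X (H k)"
        "\<And>z. z \<in> ?I \<times> ?I \<Longrightarrow> H k z \<in> S k"
        "\<And>t. t \<in> ?I \<Longrightarrow> H k (0, t) = f (he_circle k t) \<and> H k (1, t) = g (he_circle k t)"
        "\<And>s. s \<in> ?I \<Longrightarrow> H k (s, 0) = x \<and> H k (s, 1) = x" if "k \<ge> 1" for k
    using that by (auto simp: continuous_map_in_subtopology)
  define h where "h z = he_glue (\<lambda>k t. H k (fst z, t)) (snd z)" for z
  have h: "h (s, he_circle k t) = H k (s, t)" if "s \<in> ?I" "t \<in> ?I" "k \<ge> 1" for s k t
    using that H(4) he_glue_circle [of "\<lambda>k t. H k (s, t)" x k t] by (simp add: h_def)
  have h0: "h (s, 0, 0) = x" if "s \<in> ?I" for s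
    using h [OF that, of 0 1] H(4) [of 1] that by simp
  have "continuous_map (top_of_set ?D) X (h \<circ> he_param)"
    unfolding continuous_map_eq_topcontinuous_at topcontinuous_at_def
  proof (intro ballI conjI allI impI)
    fix d assume "d \<in> topspace (top_of_set ?D)"
    then obtain s k t where d: "d = (s, 1 / real k, t)" and st: "s \<in> ?I" "t \<in> ?I"
      by (auto simp: recip_nats_def)
    show "h \<circ> he_param \<in> topspace (top_of_set ?D) \<rightarrow> topspace X"
    proof
      fix d assume "d \<in> topspace (top_of_set ?D)"
      then obtain s k t where d: "d = (s, 1 / real k, t)" and st: "s \<in> ?I" "t \<in> ?I"
        by (auto simp: recip_nats_def)
      show "(h \<circ> he_param) d \<in> topspace X"
      proof (cases "k = 0")
        case True
        then show ?thesis
          using st x by (simp add: d he_param_0 h0)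
      next
        case False
        then have "H k (s, t) \<in> topspace X"
          using continuous_map_funspace [OF H(1) [of k]] st by (auto simp: Pi_iff)
        then show ?thesis
          using st False by (simp add: d he_param_circle h)
      qed
    qed
    fix V assume V: "openin X V \<and> (h \<circ> he_param) d \<in> V"
    show "\<exists>U. openin (top_of_set ?D) U \<and> d \<in> U \<and> (\<forall>y\<in>U. (h \<circ> he_param) y \<in> V)"
    proof (cases "k = 0")
      case True
      with V have "x \<in> V"
        using st by (simp add: d he_param_0 h0)
      with V S obtain N where N: "\<And>k. \<not> S k \<subseteq> V \<Longrightarrow> k \<le> N"
        unfolding null_family_def by (metis (mono_tags, lifting) finite_nat_set_iff_bounded_le mem_Collect_eq)
      \<comment> \<open>A reciprocal below \<open>1 / (N + 1)\<close> has an index beyond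
        \<open>N\<close>, whose control set lies in \<open>V\<close>, or index \<open>0\<close>,
        where the value is \<open>x\<close>.\<close>
      define U where "U = ?D \<inter> (UNIV \<times> {..< 1 / real (Suc N)} \<times> UNIV)"
      have "(h \<circ> he_param) y \<in> V" if "y \<in> U" for y
      proof -
        from that obtain s k t where y: "y = (s, 1 / real k, t)" and st: "s \<in> ?I" "t \<in> ?I"
            and k: "1 / real k < 1 / real (Suc N)"
          by (auto simp: U_def recip_nats_def)
        show ?thesis
        proof (cases "k = 0")
          case True
          then show ?thesis
            using st \<open>x \<in> V\<close> by (simp add: y he_param_0 h0)
        next
          case False
          with k have "N < k"
            by (simp add: field_simps)
          with N have "S k \<subseteq> V"
            by (meson not_le)
          then show ?thesis
            using st False H(2) [of k "(s, t)"] by (auto simp: y he_param_circle h)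
        qed
      qed
      moreover have "openin (top_of_set ?D) U"
        unfolding U_def by (intro openin_open_Int open_Times) auto
      moreover have "d \<in> U"
        using st True by (auto simp: d U_def recip_nats_def intro: image_eqI [of _ _ 0])
      ultimately show ?thesis
        by blast
    next
      case False
      then have k: "k \<ge> 1"
        by simp
      obtain W where W: "open W" "W \<inter> recip_nats = {1 / real k}"
        using recip_nats_isolated [OF k] by blast
      have "openin (top_of_set (?I \<times> ?I)) {z \<in> topspace (top_of_set (?I \<times> ?I)). H k z \<in> V}"
        by (rule openin_continuous_map_preimage [OF H(1) [OF k]]) (use V in auto)
      then obtain O' where O': "open O'" "{z \<in> ?I \<times> ?I. H k z \<in> V} = ?I \<times> ?I \<inter> O'"
        by (auto simp: openin_open)
      \<comment> \<open>\<open>W\<close> fixes the index \<open>k\<close>, and \<open>O'\<close>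
        constrains the remaining two coordinates.\<close>
      define U where "U = ?D \<inter> (fst \<circ> snd) -` W \<inter> (\<lambda>d. (fst d, snd (snd d))) -` O'"
      have mem: "d \<in> U \<longleftrightarrow> (\<exists>s t. d = (s, 1 / real k, t) \<and> s \<in> ?I \<and> t \<in> ?I \<and> H k (s, t) \<in> V)" for d
        using O'(2) W(2) by (cases d) (auto simp: U_def set_eq_iff)
      have "openin (top_of_set ?D) U"
        unfolding U_def Int_assoc
        by (intro openin_open_Int open_Int open_vimage W O' continuous_intros)
      moreover have "d \<in> U" "\<forall>y\<in>U. (h \<circ> he_param) y \<in> V"
        using st k V by (auto simp: mem d he_param_circle h)
      ultimately show ?thesis
        by blast
    qed
  qed auto
  moreover have "h (0, z) = f z \<and> h (1, z) = g z" if "z \<in> hawaiian_earring" for z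
    using that H(3) by (auto simp: hawaiian_earring_eq h)
  ultimately show ?thesis
    unfolding hawaiian_homotopic_iff_param using h0 by blast
qed

section \<open>The Hawaiian group\<close>

lemma hawaiian_maps_iff_homotopic: "f \<in> hawaiian_maps X x \<longleftrightarrow> (f, f) \<in> hawaiian_homotopic X x"
  by (auto simp: hawaiian_maps_def hawaiian_homotopic_def)

lemma equiv_hawaiian_homotopic: "equiv (hawaiian_maps X x) (hawaiian_homotopic X x)"
proof (rule equivI)
  show "hawaiian_homotopic X x \<subseteq> hawaiian_maps X x \<times> hawaiian_maps X x"
    by (auto simp: hawaiian_maps_def hawaiian_homotopic_def
        dest: homotopic_with_imp_continuous_maps homotopic_with_imp_property)
  show "refl_on (hawaiian_maps X x) (hawaiian_homotopic X x)"
    by (simp add: refl_on_def hawaiian_maps_iff_homotopic)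
  show "sym (hawaiian_homotopic X x)"
    by (auto simp: sym_def hawaiian_homotopic_def homotopic_with_sym)
  show "trans (hawaiian_homotopic X x)"
    by (auto simp: trans_def hawaiian_homotopic_def intro: homotopic_with_trans)
qed

lemma hawaiian_class_eq_iff:
  assumes "f \<in> hawaiian_maps X x" "g \<in> hawaiian_maps X x"
  shows "hawaiian_homotopic X x `` {f} = hawaiian_homotopic X x `` {g} \<longleftrightarrow> (f, g) \<in> hawaiian_homotopic X x"
  using eq_equiv_class_iff [OF equiv_hawaiian_homotopic assms] .

section \<open>Maps on the earring, circle by circle\<close>

lemma circle_loop_origin: "f \<circ> he_circle k \<in> loops Y x \<Longrightarrow> f (0, 0) = x"
  by (simp add: loops_def)

text \<open>The loops on circle \<open>1\<close> already show that both maps send the origin to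
  \<open>x\<close>.\<close>

lemma hawaiian_homotopicI:
  assumes "x \<in> topspace X" "null_family X x S"
    and "\<And>k. k \<ge> 1 \<Longrightarrow> (f \<circ> he_circle k, g \<circ> he_circle k) \<in> loop_homotopic (subtopology X (S k)) x"
  shows "(f, g) \<in> hawaiian_homotopic X x"
  using assms loop_homotopic_imp_loops [OF assms(3) [of 1]]
  by (intro loop_homotopic_imp_hawaiian_homotopic [of x X f g S]) (auto simp: circle_loop_origin)

lemma hawaiian_mapsI:
  assumes "x \<in> topspace X" "null_family X x S"
    and "\<And>k. k \<ge> 1 \<Longrightarrow> f \<circ> he_circle k \<in> loops (subtopology X (S k)) x"
  shows "f \<in> hawaiian_maps X x"
  using assms unfolding hawaiian_maps_iff_homotopic loops_iff by (rule hawaiian_homotopicI)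

lemma hawaiian_mapsE:
  assumes "f \<in> hawaiian_maps X x"
  obtains S where "null_family X x S" "\<And>k. k \<ge> 1 \<Longrightarrow> f \<circ> he_circle k \<in> loops (subtopology X (S k)) x"
  using hawaiian_homotopic_imp_loop_homotopic [of f f X x] assms
  unfolding hawaiian_maps_iff_homotopic loops_iff by blast

lemma he_circle_loop_homotopic:
  assumes "(f, g) \<in> hawaiian_homotopic X x" "k \<ge> 1"
  shows "(f \<circ> he_circle k, g \<circ> he_circle k) \<in> loop_homotopic X x"
proof -
  obtain S where "\<forall>k\<ge>1. (f \<circ> he_circle k, g \<circ> he_circle k) \<in> loop_homotopic (subtopology X (S k)) x"
    using hawaiian_homotopic_imp_loop_homotopic [OF assms(1)] by blast
  then show ?thesis
    using assms(2) by (blast intro: loop_homotopic_subtopology)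
qed

lemma he_circle_loops: "f \<in> hawaiian_maps X x \<Longrightarrow> k \<ge> 1 \<Longrightarrow> f \<circ> he_circle k \<in> loops X x"
  by (simp add: hawaiian_maps_iff_homotopic loops_iff he_circle_loop_homotopic)

text \<open>The space may vary with the circle, so that each glued loop stays in its own control
  set. Agreement is guaranteed on the unit interval only, hence a homotopy and not an
  equation.\<close>

lemma he_glue_loop_homotopic:
  assumes "\<And>j. j \<ge> 1 \<Longrightarrow> p j \<in> loops (Y j) x" "k \<ge> 1"
  shows "(he_glue p \<circ> he_circle k, p k) \<in> loop_homotopic (Y k) x"
proof -
  have "p j 0 = x \<and> p j 1 = x" if "j \<ge> 1" for j
    using assms(1) [OF that] by (simp add: loops_def)
  then show ?thesis
    using assms by (intro loop_homotopic_sym [OF loop_homotopic_equal]) (simp_all add: he_glue_circle)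
qed

lemma he_glue_hawaiian_maps:
  assumes "x \<in> topspace X" "null_family X x S"
    and "\<And>k. k \<ge> 1 \<Longrightarrow> p k \<in> loops (subtopology X (S k)) x"
  shows "he_glue p \<in> hawaiian_maps X x"
proof (rule hawaiian_mapsI [OF assms(1,2)])
  fix k :: nat assume k: "k \<ge> 1"
  show "he_glue p \<circ> he_circle k \<in> loops (subtopology X (S k)) x"
    using he_glue_loop_homotopic [where Y = "\<lambda>k. subtopology X (S k)", OF assms(3) k]
    by (rule loop_homotopic_imp_loops)
qed

text \<open>Evaluation of \<open>he_concat\<close> on a circle and congruence in one rule; it can be
  nested, so the group laws follow from those for \<open>loop_concat\<close>.\<close>

lemma he_concat_loop_homotopic:
  assumes "(f \<circ> he_circle k, p) \<in> loop_homotopic Y x" "(g \<circ> he_circle k, q) \<in> loop_homotopic Y x" "k \<ge> 1"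
  shows "(he_concat f g \<circ> he_circle k, loop_concat p q) \<in> loop_homotopic Y x"
proof -
  have f: "f \<circ> he_circle k \<in> loops Y x" and g: "g \<circ> he_circle k \<in> loops Y x"
    using assms(1,2) [THEN loop_homotopic_imp_loops(1)] .
  have "(loop_concat (f \<circ> he_circle k) (g \<circ> he_circle k), he_concat f g \<circ> he_circle k) \<in> loop_homotopic Y x"
    using he_concat_circle [of f x g k, OF circle_loop_origin [OF f] circle_loop_origin [OF g] assms(3)]
    by (intro loop_homotopic_equal loops_concat f g) simp
  from loop_homotopic_sym [OF this] show ?thesis
    by (rule loop_homotopic_trans) (rule loop_concat_cong [OF assms(1,2)])
qed

section \<open>Group laws for maps on the earring\<close>

lemma he_concat_cong:
  assumes x: "x \<in> topspace X"
    and f: "(f, f') \<in> hawaiian_homotopic X x" and g: "(g, g') \<in> hawaiian_homotopic X x"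
  shows "(he_concat f g, he_concat f' g') \<in> hawaiian_homotopic X x"
proof -
  obtain S where S: "null_family X x S"
      "\<And>k. k \<ge> 1 \<Longrightarrow> (f \<circ> he_circle k, f' \<circ> he_circle k) \<in> loop_homotopic (subtopology X (S k)) x"
    using hawaiian_homotopic_imp_loop_homotopic [OF f] by blast
  obtain T where T: "null_family X x T"
      "\<And>k. k \<ge> 1 \<Longrightarrow> (g \<circ> he_circle k, g' \<circ> he_circle k) \<in> loop_homotopic (subtopology X (T k)) x"
    using hawaiian_homotopic_imp_loop_homotopic [OF g] by blast
  show ?thesis
  proof (rule hawaiian_homotopicI [OF x null_family_Un [OF S(1) T(1)]])
    fix k :: nat assume k: "k \<ge> 1"
    let ?Y = "subtopology X (S k \<union> T k)"
    have f: "(f \<circ> he_circle k, f' \<circ> he_circle k) \<in> loop_homotopic ?Y x"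
      using S(2) [OF k] by (rule loop_homotopic_mono) auto
    have g: "(g \<circ> he_circle k, g' \<circ> he_circle k) \<in> loop_homotopic ?Y x"
      using T(2) [OF k] by (rule loop_homotopic_mono) auto
    have "f' \<circ> he_circle k \<in> loops ?Y x" "g' \<circ> he_circle k \<in> loops ?Y x"
      using f g by (simp_all add: loop_homotopic_imp_loops(2))
    then have "(he_concat f' g' \<circ> he_circle k, loop_concat (f' \<circ> he_circle k) (g' \<circ> he_circle k)) \<in> loop_homotopic ?Y x"
      using k by (intro he_concat_loop_homotopic) (auto simp flip: loops_iff)
    from he_concat_loop_homotopic [OF f g k] loop_homotopic_sym [OF this]
    show "(he_concat f g \<circ> he_circle k, he_concat f' g' \<circ> he_circle k) \<in> loop_homotopic ?Y x"
      by (rule loop_homotopic_trans)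
  qed
qed

lemma he_concat_maps:
  "x \<in> topspace X \<Longrightarrow> f \<in> hawaiian_maps X x \<Longrightarrow> g \<in> hawaiian_maps X x \<Longrightarrow> he_concat f g \<in> hawaiian_maps X x"
  by (simp add: hawaiian_maps_iff_homotopic he_concat_cong)

lemma he_concat_assoc:
  assumes x: "x \<in> topspace X"
    and f: "f \<in> hawaiian_maps X x" and g: "g \<in> hawaiian_maps X x" and h: "h \<in> hawaiian_maps X x"
  shows "(he_concat (he_concat f g) h, he_concat f (he_concat g h)) \<in> hawaiian_homotopic X x"
proof -
  obtain S where S: "null_family X x S" "\<And>k. k \<ge> 1 \<Longrightarrow> f \<circ> he_circle k \<in> loops (subtopology X (S k)) x"
    using hawaiian_mapsE [OF f] by blast
  obtain T where T: "null_family X x T" "\<And>k. k \<ge> 1 \<Longrightarrow> g \<circ> he_circle k \<in> loops (subtopology X (T k)) x"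
    using hawaiian_mapsE [OF g] by blast
  obtain R where R: "null_family X x R" "\<And>k. k \<ge> 1 \<Longrightarrow> h \<circ> he_circle k \<in> loops (subtopology X (R k)) x"
    using hawaiian_mapsE [OF h] by blast
  show ?thesis
  proof (rule hawaiian_homotopicI [OF x null_family_Un [OF null_family_Un [OF S(1) T(1)] R(1)]])
    fix k :: nat assume k: "k \<ge> 1"
    let ?Y = "subtopology X (S k \<union> T k \<union> R k)"
    let ?f = "f \<circ> he_circle k" and ?g = "g \<circ> he_circle k" and ?h = "h \<circ> he_circle k"
    have l: "?f \<in> loops ?Y x" "?g \<in> loops ?Y x" "?h \<in> loops ?Y x"
      using S(2) [OF k] T(2) [OF k] R(2) [OF k] by (auto elim!: loops_mono)
    then have r: "(?f, ?f) \<in> loop_homotopic ?Y x" "(?g, ?g) \<in> loop_homotopic ?Y x" "(?h, ?h) \<in> loop_homotopic ?Y x"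
      by (simp_all flip: loops_iff)
    have "(he_concat (he_concat f g) h \<circ> he_circle k, loop_concat (loop_concat ?f ?g) ?h) \<in> loop_homotopic ?Y x"
      by (intro he_concat_loop_homotopic r k)
    also have "(loop_concat (loop_concat ?f ?g) ?h, loop_concat ?f (loop_concat ?g ?h)) \<in> loop_homotopic ?Y x"
      by (intro loop_concat_assoc l)
    also have "(loop_concat ?f (loop_concat ?g ?h), he_concat f (he_concat g h) \<circ> he_circle k) \<in> loop_homotopic ?Y x"
      by (intro loop_homotopic_sym [OF he_concat_loop_homotopic] he_concat_loop_homotopic r k)
    finally show "(he_concat (he_concat f g) h \<circ> he_circle k, he_concat f (he_concat g h) \<circ> he_circle k)
      \<in> loop_homotopic ?Y x" .
  qed
qed

lemma const_he_circle: "(\<lambda>z. x) \<circ> he_circle k = (\<lambda>t. x)"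
  by (simp add: fun_eq_iff)

lemma null_family_const: "null_family X x (\<lambda>k. {x})"
  by (simp add: null_family_def)

lemma hawaiian_maps_const: "x \<in> topspace X \<Longrightarrow> (\<lambda>z. x) \<in> hawaiian_maps X x"
  by (simp add: hawaiian_maps_def)

lemma he_concat_const_left:
  assumes x: "x \<in> topspace X" and f: "f \<in> hawaiian_maps X x"
  shows "(he_concat (\<lambda>z. x) f, f) \<in> hawaiian_homotopic X x"
proof -
  obtain S where S: "null_family X x S" "\<And>k. k \<ge> 1 \<Longrightarrow> f \<circ> he_circle k \<in> loops (subtopology X (S k)) x"
    using hawaiian_mapsE [OF f] by blast
  show ?thesis
  proof (rule hawaiian_homotopicI [OF x null_family_Un [OF S(1) null_family_const]])
    fix k :: nat assume k: "k \<ge> 1"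
    let ?Y = "subtopology X (S k \<union> {x})"
    have l: "f \<circ> he_circle k \<in> loops ?Y x"
      using S(2) [OF k] by (rule loops_mono) auto
    have c: "(\<lambda>t. x) \<in> loops ?Y x"
      using x by (intro loops_const) simp
    have "(he_concat (\<lambda>z. x) f \<circ> he_circle k, loop_concat (\<lambda>t. x) (f \<circ> he_circle k)) \<in> loop_homotopic ?Y x"
      using l c k by (intro he_concat_loop_homotopic) (simp_all add: const_he_circle flip: loops_iff)
    also have "(loop_concat (\<lambda>t. x) (f \<circ> he_circle k), f \<circ> he_circle k) \<in> loop_homotopic ?Y x"
      by (intro loop_concat_const_left l)
    finally show "(he_concat (\<lambda>z. x) f \<circ> he_circle k, f \<circ> he_circle k) \<in> loop_homotopic ?Y x" .
  qed
qed

definition he_reverse :: "(real \<times> real \<Rightarrow> 'a) \<Rightarrow> real \<times> real \<Rightarrow> 'a" where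
  "he_reverse f = he_glue (\<lambda>k. loop_reverse (f \<circ> he_circle k))"

lemma he_reverse_loop_homotopic:
  assumes "\<And>j. j \<ge> 1 \<Longrightarrow> f \<circ> he_circle j \<in> loops (subtopology X (S j)) x" "k \<ge> 1"
  shows "(he_reverse f \<circ> he_circle k, loop_reverse (f \<circ> he_circle k)) \<in> loop_homotopic (subtopology X (S k)) x"
  unfolding he_reverse_def using assms
  by (intro he_glue_loop_homotopic [where Y = "\<lambda>j. subtopology X (S j)"] loops_reverse)

lemma he_reverse_maps:
  assumes x: "x \<in> topspace X" and f: "f \<in> hawaiian_maps X x"
  shows "he_reverse f \<in> hawaiian_maps X x"
proof -
  obtain S where S: "null_family X x S" "\<And>k. k \<ge> 1 \<Longrightarrow> f \<circ> he_circle k \<in> loops (subtopology X (S k)) x"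
    using hawaiian_mapsE [OF f] by blast
  show ?thesis
    unfolding he_reverse_def by (rule he_glue_hawaiian_maps [OF x S(1) loops_reverse [OF S(2)]])
qed

lemma he_concat_reverse_left:
  assumes x: "x \<in> topspace X" and f: "f \<in> hawaiian_maps X x"
  shows "(he_concat (he_reverse f) f, \<lambda>z. x) \<in> hawaiian_homotopic X x"
proof -
  obtain S where S: "null_family X x S" "\<And>k. k \<ge> 1 \<Longrightarrow> f \<circ> he_circle k \<in> loops (subtopology X (S k)) x"
    using hawaiian_mapsE [OF f] by blast
  show ?thesis
  proof (rule hawaiian_homotopicI [OF x S(1)], unfold const_he_circle)
    fix k :: nat assume k: "k \<ge> 1"
    let ?Y = "subtopology X (S k)" and ?f = "f \<circ> he_circle k"
    have "(he_concat (he_reverse f) f \<circ> he_circle k, loop_concat (loop_reverse ?f) ?f) \<in> loop_homotopic ?Y x"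
      using S(2) k by (intro he_concat_loop_homotopic he_reverse_loop_homotopic) (auto simp flip: loops_iff)
    also have "(loop_concat (loop_reverse ?f) ?f, \<lambda>t. x) \<in> loop_homotopic ?Y x"
      by (intro loop_concat_reverse_left S k)
    finally show "(he_concat (he_reverse f) f \<circ> he_circle k, \<lambda>t. x) \<in> loop_homotopic ?Y x" .
  qed
qed

lemma
  assumes x: "x \<in> topspace X"
  shows group_hawaiian_group: "group (hawaiian_group X x)"
    and mult_hawaiian_group: "f \<in> hawaiian_maps X x \<Longrightarrow> g \<in> hawaiian_maps X x \<Longrightarrow>
      hawaiian_homotopic X x `` {f} \<otimes>\<^bsub>hawaiian_group X x\<^esub> hawaiian_homotopic X x `` {g} =
      hawaiian_homotopic X x `` {he_concat f g}"
proof -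
  have inv: "\<exists>g\<in>hawaiian_maps X x. (he_concat g f, \<lambda>z. x) \<in> hawaiian_homotopic X x"
    if "f \<in> hawaiian_maps X x" for f
    by (intro bexI [of _ "he_reverse f"] he_concat_reverse_left he_reverse_maps x that)
  note * = quotient_group [where c = he_concat, OF equiv_hawaiian_homotopic he_concat_maps [OF x]
    he_concat_cong [OF x] hawaiian_maps_const [OF x] he_concat_assoc [OF x] he_concat_const_left [OF x]
    inv hawaiian_group_def]
  show "group (hawaiian_group X x)"
    by (rule *(1))
  show "f \<in> hawaiian_maps X x \<Longrightarrow> g \<in> hawaiian_maps X x \<Longrightarrow>
      hawaiian_homotopic X x `` {f} \<otimes>\<^bsub>hawaiian_group X x\<^esub> hawaiian_homotopic X x `` {g} =
      hawaiian_homotopic X x `` {he_concat f g}"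
    by (rule *(2))
qed

lemma carrier_hawaiian_group:
    "carrier (hawaiian_group X x) = hawaiian_maps X x // hawaiian_homotopic X x"
  and one_hawaiian_group: "\<one>\<^bsub>hawaiian_group X x\<^esub> = hawaiian_homotopic X x `` {\<lambda>z. x}"
  by (simp_all add: hawaiian_group_def)

lemma inv_hawaiian_group:
  assumes x: "x \<in> topspace X" and f: "f \<in> hawaiian_maps X x"
  shows "inv\<^bsub>hawaiian_group X x\<^esub> (hawaiian_homotopic X x `` {f}) = hawaiian_homotopic X x `` {he_reverse f}"
proof (rule group.inv_equality [OF group_hawaiian_group [OF x]])
  show "hawaiian_homotopic X x `` {he_reverse f} \<otimes>\<^bsub>hawaiian_group X x\<^esub> hawaiian_homotopic X x `` {f} =
      \<one>\<^bsub>hawaiian_group X x\<^esub>"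
    using assms by (simp add: mult_hawaiian_group he_reverse_maps one_hawaiian_group
        equiv_class_eq [OF equiv_hawaiian_homotopic he_concat_reverse_left])
qed (use assms in \<open>auto simp: carrier_hawaiian_group he_reverse_maps quotientI\<close>)

section \<open>The weak product as a normal subgroup\<close>

text \<open>The contractions of almost all circles run along a null family, so that they fit together.\<close>

definition almost_trivial :: "'a topology \<Rightarrow> 'a \<Rightarrow> (real \<times> real \<Rightarrow> 'a) \<Rightarrow> bool" where
  "almost_trivial X x f \<longleftrightarrow> f \<in> hawaiian_maps X x \<and> (\<exists>F S. finite F \<and> null_family X x S \<and>
     (\<forall>k\<ge>1. k \<notin> F \<longrightarrow> (f \<circ> he_circle k, \<lambda>t. x) \<in> loop_homotopic (subtopology X (S k)) x))"

text \<open>On almost trivial maps this inverts the weak embedding. It is \<open>undefined\<close>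
  outside \<open>{1..}\<close>, as tuples in the carrier of the product are extensional.\<close>

definition loop_classes :: "'a topology \<Rightarrow> 'a \<Rightarrow> (real \<times> real \<Rightarrow> 'a) \<Rightarrow> nat \<Rightarrow> (real \<Rightarrow> 'a) set" where
  "loop_classes X x f = (\<lambda>k\<in>{1..}. loop_homotopic X x `` {f \<circ> he_circle k})"

lemma almost_trivial_maps: "almost_trivial X x f \<Longrightarrow> f \<in> hawaiian_maps X x"
  by (simp add: almost_trivial_def)

lemma carrier_weak_fundamental_product:
  assumes "x \<in> topspace X"
  shows "carrier (weak_fundamental_product X x) =
    {n \<in> \<Pi>\<^sub>E k\<in>{1..}. carrier (fundamental_group X x).
      finite {k \<in> {1..}. n k \<noteq> \<one>\<^bsub>fundamental_group X x\<^esub>}}"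
  using assms by (simp add: weak_fundamental_product_def carrier_sum_group group_fundamental_group)

lemma null_loop_class:
  assumes "(p, \<lambda>t. x) \<in> loop_homotopic X x"
  shows "loop_homotopic X x `` {p} = \<one>\<^bsub>fundamental_group X x\<^esub>"
  using equiv_class_eq [OF equiv_loop_homotopic assms] by (simp add: one_fundamental_group)

lemma loop_classes_carrier:
  assumes x: "x \<in> topspace X" and f: "almost_trivial X x f"
  shows "loop_classes X x f \<in> carrier (weak_fundamental_product X x)"
proof -
  obtain F S where F: "finite F"
      and FS: "\<And>k. k \<ge> 1 \<Longrightarrow> k \<notin> F \<Longrightarrow> (f \<circ> he_circle k, \<lambda>t. x) \<in> loop_homotopic (subtopology X (S k)) x"
    using f unfolding almost_trivial_def by blast
  have "loop_classes X x f k = \<one>\<^bsub>fundamental_group X x\<^esub>" if "k \<ge> 1" "k \<notin> F" for k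
    using null_loop_class [OF loop_homotopic_subtopology [OF FS [OF that]]] that
    by (simp add: loop_classes_def)
  then have "{k \<in> {1..}. loop_classes X x f k \<noteq> \<one>\<^bsub>fundamental_group X x\<^esub>} \<subseteq> F"
    by auto
  then have "finite {k \<in> {1..}. loop_classes X x f k \<noteq> \<one>\<^bsub>fundamental_group X x\<^esub>}"
    using F finite_subset by blast
  moreover have "loop_classes X x f \<in> (\<Pi>\<^sub>E k\<in>{1..}. carrier (fundamental_group X x))"
    using he_circle_loops [OF almost_trivial_maps [OF f]]
    by (auto simp: loop_classes_def carrier_fundamental_group intro!: quotientI)
  ultimately show ?thesis
    by (simp add: carrier_weak_fundamental_product [OF x])
qed

text \<open>The last claim is an equation and not a homotopy, because \<open>weak_embedding\<close>
  selects maps that are literally constant off finitely many circles.\<close>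

lemma he_glue_finite:
  assumes x: "x \<in> topspace X" and F: "finite F" and p: "\<forall>k\<ge>1. p k \<in> loops X x"
  defines "g \<equiv> he_glue (\<lambda>k. if k \<in> F then p k else (\<lambda>t. x))"
  shows "almost_trivial X x g"
    and "\<And>k. k \<ge> 1 \<Longrightarrow> k \<in> F \<Longrightarrow> (g \<circ> he_circle k, p k) \<in> loop_homotopic X x"
    and "\<And>k t. k \<ge> 1 \<Longrightarrow> k \<notin> F \<Longrightarrow> t \<in> {0..1} \<Longrightarrow> g (he_circle k t) = x"
proof -
  define T where "T k = (if k \<in> F then topspace X else {x})" for k
  have T: "null_family X x T"
    by (rule null_family_modify [OF null_family_const F]) (simp add: T_def)
  have l: "(if k \<in> F then p k else (\<lambda>t. x)) \<in> loops (subtopology X (T k)) x" if "k \<ge> 1" for k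
    using p that x by (auto simp: T_def intro: loops_const)
  note hom = he_glue_loop_homotopic [where Y = "\<lambda>k. subtopology X (T k)", OF l, folded g_def]
  show eq: "g (he_circle k t) = x" if "k \<ge> 1" "k \<notin> F" "t \<in> {0..1}" for k t
    using that p unfolding g_def by (subst he_glue_circle [where x = x]) (auto simp: loops_def)
  show "(g \<circ> he_circle k, p k) \<in> loop_homotopic X x" if "k \<ge> 1" "k \<in> F" for k
    using hom [of k] that by (simp add: T_def)
  have "(g \<circ> he_circle k, \<lambda>t. x) \<in> loop_homotopic (subtopology X (T k)) x" if "k \<ge> 1" "k \<notin> F" for k
    using hom [of k] that by simp
  moreover have "g \<in> hawaiian_maps X x"
    unfolding g_def by (rule he_glue_hawaiian_maps [OF x T l])
  ultimately show "almost_trivial X x g"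
    unfolding almost_trivial_def using F T by blast
qed

text \<open>Statements about tuples can thus be proved for maps. Loops are chosen only in the
  nontrivial components; the others receive the constant loop.\<close>

lemma weak_product_representative:
  assumes x: "x \<in> topspace X" and n: "n \<in> carrier (weak_fundamental_product X x)"
  obtains f where "almost_trivial X x f" "n = loop_classes X x f"
proof -
  define F where "F = {k \<in> {1..}. n k \<noteq> \<one>\<^bsub>fundamental_group X x\<^esub>}"
  have nk: "n k \<in> loops X x // loop_homotopic X x" if "k \<ge> 1" for k
    using n that by (auto simp: carrier_weak_fundamental_product [OF x] carrier_fundamental_group PiE_iff)
  have "finite F"
    using n by (simp add: F_def carrier_weak_fundamental_product [OF x])
  have "\<exists>p. k \<ge> 1 \<longrightarrow> p \<in> loops X x \<and> n k = loop_homotopic X x `` {p}" for k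
    using nk [of k] unfolding quotient_def by blast
  then obtain p where p: "\<forall>k\<ge>1. p k \<in> loops X x" "\<And>k. k \<ge> 1 \<Longrightarrow> n k = loop_homotopic X x `` {p k}"
    by metis
  define g where "g = he_glue (\<lambda>k. if k \<in> F then p k else (\<lambda>t. x))"
  note g = he_glue_finite [of x X F p, OF x \<open>finite F\<close> p(1), folded g_def]
  have "n k = loop_classes X x g k" for k
  proof (cases "k \<ge> 1")
    case k: True
    show ?thesis
    proof (cases "k \<in> F")
      case True
      then show ?thesis
        using equiv_class_eq [OF equiv_loop_homotopic g(2) [OF k True]] k p by (simp add: loop_classes_def)
    next
      case False
      then have "(\<lambda>t. x, g \<circ> he_circle k) \<in> loop_homotopic X x"
        using g(3) [OF k] x by (intro loop_homotopic_equal loops_const) auto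
      then have "\<one>\<^bsub>fundamental_group X x\<^esub> = loop_homotopic X x `` {g \<circ> he_circle k}"
        using null_loop_class [OF loop_homotopic_sym] by metis
      with False show ?thesis
        using k by (simp add: F_def loop_classes_def)
    qed
  next
    case False
    then have "n k = undefined"
      using n by (intro PiE_arb [of n "{1..}"]) (auto simp: carrier_weak_fundamental_product [OF x])
    with False show ?thesis
      by (simp add: loop_classes_def)
  qed
  then show ?thesis
    using that g(1) by blast
qed

text \<open>Any two representatives are homotopic: off a finite set one contracts along a null
  family while the other is constant, and on the finite set uncontrolled homotopies in
  \<open>X\<close> are allowed. So the union in the definition is a single class.\<close>

lemma weak_embedding_loop_classes:
  assumes x: "x \<in> topspace X" and f: "almost_trivial X x f"
  shows "weak_embedding X x (loop_classes X x f) = hawaiian_homotopic X x `` {f}"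
proof -
  obtain F S where F: "finite F" and S: "null_family X x S"
      and FS: "\<And>k. k \<ge> 1 \<Longrightarrow> k \<notin> F \<Longrightarrow> (f \<circ> he_circle k, \<lambda>t. x) \<in> loop_homotopic (subtopology X (S k)) x"
    using f unfolding almost_trivial_def by blast
  define A where "A = {g \<in> hawaiian_maps X x.
       finite {k \<in> {1..}. \<exists>t\<in>{0..1}. g (he_circle k t) \<noteq> x} \<and>
       (\<forall>k\<in>{1..}. g \<circ> he_circle k \<in> loop_classes X x f k)}"
  have A: "(f, g) \<in> hawaiian_homotopic X x" if "g \<in> A" for g
  proof -
    define F' where "F' = F \<union> {k \<in> {1..}. \<exists>t\<in>{0..1}. g (he_circle k t) \<noteq> x}"
    \<comment> \<open>The whole space where only equality of loop classes is known, the given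
      control elsewhere.\<close>
    define T where "T k = (if k \<in> F' then topspace X else insert x (S k))" for k
    have "finite F'"
      using that F by (simp add: F'_def A_def)
    then have T: "null_family X x T"
      by (rule null_family_modify [OF S]) (simp add: T_def)
    have "(f \<circ> he_circle k, g \<circ> he_circle k) \<in> loop_homotopic (subtopology X (T k)) x" if k: "k \<ge> 1" for k
    proof (cases "k \<in> F'")
      case True
      have "(f \<circ> he_circle k, g \<circ> he_circle k) \<in> loop_homotopic X x"
        using \<open>g \<in> A\<close> k by (auto simp: A_def loop_classes_def)
      with True show ?thesis
        by (simp add: T_def)
    next
      case False
      then have "k \<notin> F" and gx: "\<And>t. t \<in> {0..1} \<Longrightarrow> g (he_circle k t) = x" and Tk: "T k = insert x (S k)"
        using k by (auto simp: F'_def T_def)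
      have "(f \<circ> he_circle k, \<lambda>t. x) \<in> loop_homotopic (subtopology X (T k)) x"
        using FS [OF k \<open>k \<notin> F\<close>] by (rule loop_homotopic_mono) (auto simp: Tk)
      also have "(\<lambda>t. x, g \<circ> he_circle k) \<in> loop_homotopic (subtopology X (T k)) x"
        using x by (intro loop_homotopic_equal loops_const) (simp_all add: Tk gx)
      finally show ?thesis .
    qed
    then show ?thesis
      by (rule hawaiian_homotopicI [OF x T])
  qed
  \<comment> \<open>A witness that \<open>A\<close> is nonempty; otherwise the union over
    \<open>A\<close> would be empty.\<close>
  define g where "g = he_glue (\<lambda>k. if k \<in> F then f \<circ> he_circle k else (\<lambda>t. x))"
  have "\<forall>k\<ge>1. f \<circ> he_circle k \<in> loops X x"
    by (simp add: he_circle_loops almost_trivial_maps [OF f])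
  note g = he_glue_finite [of x X F "\<lambda>k. f \<circ> he_circle k", OF x F this, folded g_def]
  have "(f \<circ> he_circle k, g \<circ> he_circle k) \<in> loop_homotopic X x" if k: "k \<ge> 1" for k
  proof (cases "k \<in> F")
    case True
    then show ?thesis
      using loop_homotopic_sym [OF g(2) [OF k True]] by simp
  next
    case False
    have "(f \<circ> he_circle k, \<lambda>t. x) \<in> loop_homotopic X x"
      using FS [OF k False] by (rule loop_homotopic_subtopology)
    also have "(\<lambda>t. x, g \<circ> he_circle k) \<in> loop_homotopic X x"
      using g(3) [OF k False] x by (intro loop_homotopic_equal loops_const) auto
    finally show ?thesis .
  qed
  moreover have "{k \<in> {1..}. \<exists>t\<in>{0..1}. g (he_circle k t) \<noteq> x} \<subseteq> F"
  proof (rule subsetI, elim CollectE conjE bexE)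
    fix k and t :: real assume "k \<in> {1..}" "t \<in> {0..1}" "g (he_circle k t) \<noteq> x"
    then show "k \<in> F"
      using g(3) [of k t] by auto
  qed
  then have "finite {k \<in> {1..}. \<exists>t\<in>{0..1}. g (he_circle k t) \<noteq> x}"
    using F finite_subset by blast
  ultimately have "g \<in> A"
    using almost_trivial_maps [OF g(1)] by (simp add: A_def loop_classes_def)
  have "weak_embedding X x (loop_classes X x f) = (\<Union>g\<in>A. hawaiian_homotopic X x `` {g})"
    unfolding weak_embedding_def A_def by blast
  also have "\<dots> = (\<Union>g\<in>A. hawaiian_homotopic X x `` {f})"
    by (intro SUP_cong refl equiv_class_eq [OF equiv_hawaiian_homotopic A, symmetric])
  also have "\<dots> = hawaiian_homotopic X x `` {f}"
    using \<open>g \<in> A\<close> by blast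
  finally show ?thesis .
qed

section \<open>Products and conjugates of almost trivial maps\<close>

lemma almost_trivial_concat:
  assumes x: "x \<in> topspace X" and f: "almost_trivial X x f" and g: "almost_trivial X x g"
  shows "almost_trivial X x (he_concat f g)"
proof -
  obtain F S where F: "finite F" and S: "null_family X x S"
      and FS: "\<And>k. k \<ge> 1 \<Longrightarrow> k \<notin> F \<Longrightarrow> (f \<circ> he_circle k, \<lambda>t. x) \<in> loop_homotopic (subtopology X (S k)) x"
    using f unfolding almost_trivial_def by blast
  obtain F' T where F': "finite F'" and T: "null_family X x T"
      and FT: "\<And>k. k \<ge> 1 \<Longrightarrow> k \<notin> F' \<Longrightarrow> (g \<circ> he_circle k, \<lambda>t. x) \<in> loop_homotopic (subtopology X (T k)) x"
    using g unfolding almost_trivial_def by blast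
  have "(he_concat f g \<circ> he_circle k, \<lambda>t. x) \<in> loop_homotopic (subtopology X (S k \<union> T k)) x"
    if k: "k \<ge> 1" "k \<notin> F \<union> F'" for k
  proof -
    let ?Y = "subtopology X (S k \<union> T k)"
    have f: "(f \<circ> he_circle k, \<lambda>t. x) \<in> loop_homotopic ?Y x"
      by (rule loop_homotopic_mono [OF FS]) (use k in auto)
    have g: "(g \<circ> he_circle k, \<lambda>t. x) \<in> loop_homotopic ?Y x"
      by (rule loop_homotopic_mono [OF FT]) (use k in auto)
    have "(he_concat f g \<circ> he_circle k, loop_concat (\<lambda>t. x) (\<lambda>t. x)) \<in> loop_homotopic ?Y x"
      by (intro he_concat_loop_homotopic f g k)
    also have "(loop_concat (\<lambda>t. x) (\<lambda>t. x), \<lambda>t. x) \<in> loop_homotopic ?Y x"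
      using loop_homotopic_imp_loops(2) [OF f] by (rule loop_concat_const_left)
    finally show ?thesis .
  qed
  moreover have "he_concat f g \<in> hawaiian_maps X x"
    using f g by (intro he_concat_maps x almost_trivial_maps)
  ultimately show ?thesis
    unfolding almost_trivial_def using F F' null_family_Un [OF S T]
    by (intro conjI exI [of _ "F \<union> F'"] exI [of _ "\<lambda>k. S k \<union> T k"]) auto
qed

text \<open>Even where \<open>f\<close> is constant, the conjugate need not be. This is why
  \<open>almost_trivial\<close> asks for controlled contractions and not for constancy; here the
  control set of \<open>g\<close> joins that of \<open>f\<close>.\<close>

lemma almost_trivial_conjugate:
  assumes x: "x \<in> topspace X" and f: "almost_trivial X x f" and g: "g \<in> hawaiian_maps X x"
  shows "almost_trivial X x (he_concat (he_concat g f) (he_reverse g))"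
proof -
  obtain F S where F: "finite F" and S: "null_family X x S"
      and FS: "\<And>k. k \<ge> 1 \<Longrightarrow> k \<notin> F \<Longrightarrow> (f \<circ> he_circle k, \<lambda>t. x) \<in> loop_homotopic (subtopology X (S k)) x"
    using f unfolding almost_trivial_def by blast
  obtain T where T: "null_family X x T" "\<And>k. k \<ge> 1 \<Longrightarrow> g \<circ> he_circle k \<in> loops (subtopology X (T k)) x"
    using hawaiian_mapsE [OF g] by blast
  have g_loop: "g \<circ> he_circle k \<in> loops (subtopology X (S k \<union> T k)) x" if "k \<ge> 1" for k
    using T(2) [OF that] by (rule loops_mono) auto
  have "(he_concat (he_concat g f) (he_reverse g) \<circ> he_circle k, \<lambda>t. x)
      \<in> loop_homotopic (subtopology X (S k \<union> T k)) x" if k: "k \<ge> 1" "k \<notin> F" for k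
  proof -
    let ?Y = "subtopology X (S k \<union> T k)" and ?g = "g \<circ> he_circle k"
    have f: "(f \<circ> he_circle k, \<lambda>t. x) \<in> loop_homotopic ?Y x"
      using FS [OF k] by (rule loop_homotopic_mono) auto
    have gg: "(?g, ?g) \<in> loop_homotopic ?Y x"
      using g_loop [OF k(1)] by (simp flip: loops_iff)
    have r: "(loop_reverse ?g, loop_reverse ?g) \<in> loop_homotopic ?Y x"
      using loops_reverse [OF g_loop [OF k(1)]] by (simp flip: loops_iff)
    have "(he_concat (he_concat g f) (he_reverse g) \<circ> he_circle k,
        loop_concat (loop_concat ?g (\<lambda>t. x)) (loop_reverse ?g)) \<in> loop_homotopic ?Y x"
      by (intro he_concat_loop_homotopic he_reverse_loop_homotopic [where S = "\<lambda>k. S k \<union> T k"]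
          gg f g_loop k(1))
    also have "(loop_concat (loop_concat ?g (\<lambda>t. x)) (loop_reverse ?g), loop_concat ?g (loop_reverse ?g))
        \<in> loop_homotopic ?Y x"
      by (intro loop_concat_cong loop_concat_const_right g_loop k(1) r)
    also have "(loop_concat ?g (loop_reverse ?g), \<lambda>t. x) \<in> loop_homotopic ?Y x"
      by (intro loop_concat_reverse_right g_loop k(1))
    finally show ?thesis .
  qed
  moreover have "he_concat (he_concat g f) (he_reverse g) \<in> hawaiian_maps X x"
    using almost_trivial_maps [OF f] by (intro he_concat_maps he_reverse_maps x g)
  ultimately show ?thesis
    unfolding almost_trivial_def using F null_family_Un [OF S T(1)]
    by (intro conjI exI [of _ F] exI [of _ "\<lambda>k. S k \<union> T k"]) auto
qed

lemma loop_classes_concat: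
  assumes x: "x \<in> topspace X" and f: "f \<in> hawaiian_maps X x" and g: "g \<in> hawaiian_maps X x"
  shows "loop_classes X x (he_concat f g) = loop_classes X x f \<otimes>\<^bsub>weak_fundamental_product X x\<^esub> loop_classes X x g"
proof -
  have "loop_homotopic X x `` {he_concat f g \<circ> he_circle k} =
      loop_homotopic X x `` {f \<circ> he_circle k} \<otimes>\<^bsub>fundamental_group X x\<^esub> loop_homotopic X x `` {g \<circ> he_circle k}"
    if k: "k \<ge> 1" for k
  proof -
    have l: "f \<circ> he_circle k \<in> loops X x" "g \<circ> he_circle k \<in> loops X x"
      using k f g by (simp_all add: he_circle_loops)
    then have "(he_concat f g \<circ> he_circle k, loop_concat (f \<circ> he_circle k) (g \<circ> he_circle k)) \<in> loop_homotopic X x"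
      using k by (intro he_concat_loop_homotopic) (simp_all flip: loops_iff)
    then show ?thesis
      using mult_fundamental_group [OF x l] equiv_class_eq [OF equiv_loop_homotopic] by metis
  qed
  then show ?thesis
    by (simp add: loop_classes_def weak_fundamental_product_def fun_eq_iff)
qed

lemma weak_embedding_hom:
  assumes x: "x \<in> topspace X"
  shows "weak_embedding X x \<in> hom (weak_fundamental_product X x) (hawaiian_group X x)"
proof (rule homI)
  fix n assume "n \<in> carrier (weak_fundamental_product X x)"
  then obtain f where "almost_trivial X x f" "n = loop_classes X x f"
    by (rule weak_product_representative [OF x])
  then show "weak_embedding X x n \<in> carrier (hawaiian_group X x)"
    by (simp add: weak_embedding_loop_classes x carrier_hawaiian_group almost_trivial_maps quotientI)
next
  fix m n
  assume "m \<in> carrier (weak_fundamental_product X x)" and n: "n \<in> carrier (weak_fundamental_product X x)"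
  then obtain f where f: "almost_trivial X x f" "m = loop_classes X x f"
    by (metis weak_product_representative [OF x])
  obtain g where g: "almost_trivial X x g" "n = loop_classes X x g"
    using n by (rule weak_product_representative [OF x])
  show "weak_embedding X x (m \<otimes>\<^bsub>weak_fundamental_product X x\<^esub> n) =
      weak_embedding X x m \<otimes>\<^bsub>hawaiian_group X x\<^esub> weak_embedding X x n"
    using f g x by (simp add: weak_embedding_loop_classes mult_hawaiian_group almost_trivial_maps
        almost_trivial_concat flip: loop_classes_concat)
qed

lemma loop_classes_eq:
  assumes "(f, g) \<in> hawaiian_homotopic X x"
  shows "loop_classes X x f = loop_classes X x g"
  using equiv_class_eq [OF equiv_loop_homotopic he_circle_loop_homotopic [OF assms]]
  by (simp add: loop_classes_def fun_eq_iff)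

text \<open>Loop classes are homotopy invariant, so the tuple can be read off from any map in its
  class.\<close>

lemma inj_on_weak_embedding:
  assumes x: "x \<in> topspace X"
  shows "inj_on (weak_embedding X x) (carrier (weak_fundamental_product X x))"
proof (rule inj_onI)
  fix m n
  assume m: "m \<in> carrier (weak_fundamental_product X x)" and n: "n \<in> carrier (weak_fundamental_product X x)"
    and eq: "weak_embedding X x m = weak_embedding X x n"
  obtain f where f: "almost_trivial X x f" "m = loop_classes X x f"
    using m by (rule weak_product_representative [OF x])
  obtain g where g: "almost_trivial X x g" "n = loop_classes X x g"
    using n by (rule weak_product_representative [OF x])
  have "(f, g) \<in> hawaiian_homotopic X x"
    using eq f g by (simp add: weak_embedding_loop_classes x hawaiian_class_eq_iff almost_trivial_maps)
  with f g show "m = n"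
    by (simp add: loop_classes_eq)
qed

lemma weak_embedding_conjugate:
  assumes x: "x \<in> topspace X" and a: "a \<in> carrier (hawaiian_group X x)"
    and n: "n \<in> carrier (weak_fundamental_product X x)"
  shows "a \<otimes>\<^bsub>hawaiian_group X x\<^esub> weak_embedding X x n \<otimes>\<^bsub>hawaiian_group X x\<^esub> inv\<^bsub>hawaiian_group X x\<^esub> a
    \<in> weak_embedding X x ` carrier (weak_fundamental_product X x)"
proof -
  obtain f where f: "almost_trivial X x f" "n = loop_classes X x f"
    using n by (rule weak_product_representative [OF x])
  obtain g where g: "g \<in> hawaiian_maps X x" "a = hawaiian_homotopic X x `` {g}"
    using a by (auto simp: carrier_hawaiian_group elim: quotientE)
  let ?h = "he_concat (he_concat g f) (he_reverse g)"
  have h: "almost_trivial X x ?h"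
    by (rule almost_trivial_conjugate [OF x f(1) g(1)])
  have "a \<otimes>\<^bsub>hawaiian_group X x\<^esub> weak_embedding X x n \<otimes>\<^bsub>hawaiian_group X x\<^esub> inv\<^bsub>hawaiian_group X x\<^esub> a
      = hawaiian_homotopic X x `` {?h}"
    using f g x by (simp add: weak_embedding_loop_classes inv_hawaiian_group mult_hawaiian_group
        almost_trivial_maps he_reverse_maps he_concat_maps)
  also have "\<dots> = weak_embedding X x (loop_classes X x ?h)"
    by (simp add: weak_embedding_loop_classes x h)
  finally show ?thesis
    using loop_classes_carrier [OF x h] by simp
qed

section \<open>The complement and the wedge\<close>

lemma hawaiian_homotopic_subtopology:
  assumes "(f, g) \<in> hawaiian_homotopic (subtopology X V) x"
  shows "(f, g) \<in> hawaiian_homotopic X x"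
proof -
  have "homotopic_with (\<lambda>h. h (0, 0) = x) (top_of_set hawaiian_earring) (subtopology X V) f g"
    using assms by (simp add: hawaiian_homotopic_def)
  from homotopic_with_compose_continuous_map_left [OF this continuous_map_id_subt, of "\<lambda>h. h (0, 0) = x"]
  show ?thesis
    by (simp add: hawaiian_homotopic_def)
qed

lemma hawaiian_maps_subtopology: "f \<in> hawaiian_maps (subtopology X V) x \<Longrightarrow> f \<in> hawaiian_maps X x"
  by (simp add: hawaiian_maps_iff_homotopic hawaiian_homotopic_subtopology)

lemma hawaiian_group_map_inclusion:
  assumes f: "f \<in> hawaiian_maps (subtopology X V) x"
  shows "hawaiian_group_map X x (\<lambda>z. z) (hawaiian_homotopic (subtopology X V) x `` {f}) =
    hawaiian_homotopic X x `` {f}"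
proof -
  have eq: "(\<lambda>z. z) \<circ> g = g" for g :: "real \<times> real \<Rightarrow> 'a"
    by (simp add: fun_eq_iff)
  have "hawaiian_group_map X x (\<lambda>z. z) (hawaiian_homotopic (subtopology X V) x `` {f}) =
      (\<Union>g\<in>hawaiian_homotopic (subtopology X V) x `` {f}. hawaiian_homotopic X x `` {f})"
    unfolding hawaiian_group_map_def eq
    by (intro SUP_cong refl equiv_class_eq [OF equiv_hawaiian_homotopic, symmetric]
        hawaiian_homotopic_subtopology [of _ _ X V]) simp
  also have "\<dots> = hawaiian_homotopic X x `` {f}"
    using f by (auto simp: hawaiian_maps_iff_homotopic)
  finally show ?thesis .
qed

lemma hawaiian_group_map_inclusion_image:
  "hawaiian_group_map X x (\<lambda>z. z) ` carrier (hawaiian_group (subtopology X V) x) =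
    (\<lambda>f. hawaiian_homotopic X x `` {f}) ` hawaiian_maps (subtopology X V) x"
proof -
  have "carrier (hawaiian_group (subtopology X V) x) =
      (\<lambda>f. hawaiian_homotopic (subtopology X V) x `` {f}) ` hawaiian_maps (subtopology X V) x"
    by (auto simp: carrier_hawaiian_group quotient_def)
  then show ?thesis
    by (simp add: image_image hawaiian_group_map_inclusion cong: image_cong)
qed

text \<open>\<open>he_concat\<close> and \<open>he_reverse\<close> do not mention the space, so
  products and inverses formed in the subspace are the same functions in \<open>X\<close>.\<close>

lemma subgroup_hawaiian_group_inclusion:
  assumes x: "x \<in> topspace X" "x \<in> V"
  shows "subgroup (hawaiian_group_map X x (\<lambda>z. z) ` carrier (hawaiian_group (subtopology X V) x))
    (hawaiian_group X x)"
  unfolding hawaiian_group_map_inclusion_image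
proof
  have xV: "x \<in> topspace (subtopology X V)"
    using x by simp
  show "(\<lambda>f. hawaiian_homotopic X x `` {f}) ` hawaiian_maps (subtopology X V) x \<subseteq> carrier (hawaiian_group X x)"
    unfolding carrier_hawaiian_group
    by (rule image_subsetI) (rule quotientI [OF hawaiian_maps_subtopology])
  show "\<one>\<^bsub>hawaiian_group X x\<^esub> \<in> (\<lambda>f. hawaiian_homotopic X x `` {f}) ` hawaiian_maps (subtopology X V) x"
    unfolding one_hawaiian_group by (intro imageI hawaiian_maps_const xV)
  fix a assume "a \<in> (\<lambda>f. hawaiian_homotopic X x `` {f}) ` hawaiian_maps (subtopology X V) x"
  then obtain f where f: "a = hawaiian_homotopic X x `` {f}" "f \<in> hawaiian_maps (subtopology X V) x"
    by (rule imageE)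
  have "inv\<^bsub>hawaiian_group X x\<^esub> a = hawaiian_homotopic X x `` {he_reverse f}"
    unfolding f(1) by (intro inv_hawaiian_group x hawaiian_maps_subtopology [OF f(2)])
  then show "inv\<^bsub>hawaiian_group X x\<^esub> a \<in> (\<lambda>f. hawaiian_homotopic X x `` {f}) ` hawaiian_maps (subtopology X V) x"
    using he_reverse_maps [OF xV f(2)] by (rule image_eqI)
  fix b assume "b \<in> (\<lambda>f. hawaiian_homotopic X x `` {f}) ` hawaiian_maps (subtopology X V) x"
  then obtain g where g: "b = hawaiian_homotopic X x `` {g}" "g \<in> hawaiian_maps (subtopology X V) x"
    by (rule imageE)
  have "a \<otimes>\<^bsub>hawaiian_group X x\<^esub> b = hawaiian_homotopic X x `` {he_concat f g}"
    unfolding f(1) g(1)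
    by (intro mult_hawaiian_group x hawaiian_maps_subtopology [OF f(2)] hawaiian_maps_subtopology [OF g(2)])
  then show "a \<otimes>\<^bsub>hawaiian_group X x\<^esub> b \<in> (\<lambda>f. hawaiian_homotopic X x `` {f}) ` hawaiian_maps (subtopology X V) x"
    using he_concat_maps [OF xV f(2) g(2)] by (rule image_eqI)
qed

text \<open>Circles whose control set leaves \<open>V\<close> are given to \<open>g\<close>, all
  others to \<open>h\<close>. On each circle one factor is constant, so the product returns the loop
  of \<open>f\<close>.\<close>

lemma hawaiian_map_factorization:
  assumes V: "openin X V" "x \<in> V" and f: "f \<in> hawaiian_maps X x"
  obtains g h where "almost_trivial X x g" "h \<in> hawaiian_maps (subtopology X V) x"
    "(f, he_concat g h) \<in> hawaiian_homotopic X x"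
proof -
  have x: "x \<in> topspace X"
    using V openin_subset by blast
  obtain S where S: "null_family X x S" "\<And>k. k \<ge> 1 \<Longrightarrow> f \<circ> he_circle k \<in> loops (subtopology X (S k)) x"
    using hawaiian_mapsE [OF f] by blast
  define F where "F = {k. \<not> S k \<subseteq> V}"
  have F: "finite F"
    using S V by (simp add: F_def null_family_def)
  have fX: "\<forall>k\<ge>1. f \<circ> he_circle k \<in> loops X x"
    by (simp add: he_circle_loops f)
  define g where "g = he_glue (\<lambda>k. if k \<in> F then f \<circ> he_circle k else (\<lambda>t. x))"
  note g = he_glue_finite [of x X F "\<lambda>k. f \<circ> he_circle k", OF x F fX, folded g_def]
  define p where "p k = (if k \<in> F then (\<lambda>t. x) else f \<circ> he_circle k)" for k
  \<comment> \<open>\<open>R\<close> controls \<open>h\<close> and must stay inside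
    \<open>V\<close>; \<open>T\<close> controls the homotopy from the product to \<open>f\<close>
    and must contain the loops of \<open>g\<close> as well.\<close>
  define R where "R k = (if k \<in> F then {x} else S k)" for k
  define T where "T k = (if k \<in> F then topspace X else insert x (S k))" for k
  have R: "null_family X x R"
    by (rule null_family_modify [OF S(1) F]) (simp add: R_def subset_insertI)
  have T: "null_family X x T"
    by (rule null_family_modify [OF S(1) F]) (simp add: T_def)
  have RV: "V \<inter> R k = R k" for k
    using V(2) by (auto simp: R_def F_def)
  have pR: "p k \<in> loops (subtopology X (R k)) x" if "k \<ge> 1" for k
    using S(2) [OF that] x by (simp add: p_def R_def loops_const)
  have pT: "p k \<in> loops (subtopology X (T k)) x" if "k \<ge> 1" for k
    using pR [OF that] by (rule loops_mono) (auto simp: R_def T_def x)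
  \<comment> \<open>As \<open>V\<close> is open, open sets of the subspace are open in
    \<open>X\<close>, so the control carries over.\<close>
  have "null_family (subtopology X V) x R"
    using R V by (simp add: null_family_def openin_open_subtopology)
  then have h: "he_glue p \<in> hawaiian_maps (subtopology X V) x"
    by (rule he_glue_hawaiian_maps [rotated]) (use pR x V in \<open>simp_all add: subtopology_subtopology RV\<close>)
  have "(he_concat g (he_glue p) \<circ> he_circle k, f \<circ> he_circle k) \<in> loop_homotopic (subtopology X (T k)) x"
    if k: "k \<ge> 1" for k
  proof -
    let ?Y = "subtopology X (T k)"
    have h: "(he_glue p \<circ> he_circle k, p k) \<in> loop_homotopic ?Y x"
      by (rule he_glue_loop_homotopic [where Y = "\<lambda>k. subtopology X (T k)", OF pT k])
    show ?thesis
    proof (cases "k \<in> F")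
      case True
      then have Y: "?Y = X" and pk: "p k = (\<lambda>t. x)"
        by (simp_all add: T_def p_def)
      have "(he_concat g (he_glue p) \<circ> he_circle k, loop_concat (f \<circ> he_circle k) (\<lambda>t. x)) \<in> loop_homotopic X x"
        by (rule he_concat_loop_homotopic [OF g(2) [OF k True] h [unfolded Y pk] k])
      also have "(loop_concat (f \<circ> he_circle k) (\<lambda>t. x), f \<circ> he_circle k) \<in> loop_homotopic X x"
        using fX k by (simp add: loop_concat_const_right)
      finally show ?thesis
        unfolding Y .
    next
      case False
      then have pk: "p k = f \<circ> he_circle k"
        by (simp add: p_def)
      have "(\<lambda>t. x, g \<circ> he_circle k) \<in> loop_homotopic ?Y x"
        using g(3) [OF k False] x by (intro loop_homotopic_equal loops_const) (simp_all add: T_def)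
      then have "(he_concat g (he_glue p) \<circ> he_circle k, loop_concat (\<lambda>t. x) (f \<circ> he_circle k)) \<in> loop_homotopic ?Y x"
        by (rule he_concat_loop_homotopic [OF loop_homotopic_sym h [unfolded pk] k])
      also have "(loop_concat (\<lambda>t. x) (f \<circ> he_circle k), f \<circ> he_circle k) \<in> loop_homotopic ?Y x"
        using pT [OF k] unfolding pk by (rule loop_concat_const_left)
      finally show ?thesis .
    qed
  qed
  then have "(f, he_concat g (he_glue p)) \<in> hawaiian_homotopic X x"
    by (intro hawaiian_homotopicI [OF x T]) (rule loop_homotopic_sym)
  then show ?thesis
    using that g(1) h by blast
qed

text \<open>Openness of \<open>V\<close> gives the factorization of every class, and
  \<open>null\<close> gives the trivial intersection: a class of both kinds has only trivial loop
  classes, and these determine its tuple.\<close>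

lemma hawaiian_group_semidirect:
  assumes V: "openin X V" "x \<in> V"
    and null: "\<And>p. p \<in> loops (subtopology X V) x \<Longrightarrow> (p, \<lambda>t. x) \<in> loop_homotopic X x"
    and H: "H = (hawaiian_group X x)
      \<lparr>carrier := hawaiian_group_map X x (\<lambda>z. z) ` carrier (hawaiian_group (subtopology X V) x)\<rparr>"
  shows "\<exists>\<phi>\<in>hom H (AutoGroup (weak_fundamental_product X x)).
    (\<lambda>(h, n). weak_embedding X x n \<otimes>\<^bsub>hawaiian_group X x\<^esub> h)
      \<in> iso (semidirect_product H \<phi> (weak_fundamental_product X x)) (hawaiian_group X x)"
  unfolding H
proof (rule internal_semidirect_product)
  have x: "x \<in> topspace X"
    using V openin_subset by blast
  show "group (hawaiian_group X x)"
    by (rule group_hawaiian_group [OF x])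
  show "group (weak_fundamental_product X x)"
    unfolding weak_fundamental_product_def by (simp add: group_fundamental_group x)
  show "weak_embedding X x \<in> hom (weak_fundamental_product X x) (hawaiian_group X x)"
    by (rule weak_embedding_hom [OF x])
  show "inj_on (weak_embedding X x) (carrier (weak_fundamental_product X x))"
    by (rule inj_on_weak_embedding [OF x])
  show "subgroup (hawaiian_group_map X x (\<lambda>z. z) ` carrier (hawaiian_group (subtopology X V) x)) (hawaiian_group X x)"
    by (rule subgroup_hawaiian_group_inclusion [OF x V(2)])
  show "a \<otimes>\<^bsub>hawaiian_group X x\<^esub> weak_embedding X x n \<otimes>\<^bsub>hawaiian_group X x\<^esub> inv\<^bsub>hawaiian_group X x\<^esub> a
      \<in> weak_embedding X x ` carrier (weak_fundamental_product X x)"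
    if "a \<in> carrier (hawaiian_group X x)" "n \<in> carrier (weak_fundamental_product X x)" for a n
    using that by (rule weak_embedding_conjugate [OF x])
next
  have x: "x \<in> topspace X"
    using V openin_subset by blast
  fix n
  assume n: "n \<in> carrier (weak_fundamental_product X x)"
    and "weak_embedding X x n \<in> hawaiian_group_map X x (\<lambda>z. z) ` carrier (hawaiian_group (subtopology X V) x)"
  then obtain h where h: "weak_embedding X x n = hawaiian_homotopic X x `` {h}" "h \<in> hawaiian_maps (subtopology X V) x"
    unfolding hawaiian_group_map_inclusion_image by (elim imageE)
  obtain f where f: "almost_trivial X x f" "n = loop_classes X x f"
    using n by (rule weak_product_representative [OF x])
  have "(f, h) \<in> hawaiian_homotopic X x"
    using h f by (simp add: weak_embedding_loop_classes x hawaiian_class_eq_iff almost_trivial_maps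
        hawaiian_maps_subtopology [OF h(2)])
  then have "n = loop_classes X x h"
    unfolding f(2) by (rule loop_classes_eq)
  also have "\<dots> = \<one>\<^bsub>weak_fundamental_product X x\<^esub>"
    using null_loop_class [OF null [OF he_circle_loops [OF h(2)]]]
    by (simp add: loop_classes_def weak_fundamental_product_def fun_eq_iff)
  finally show "n = \<one>\<^bsub>weak_fundamental_product X x\<^esub>" .
next
  have x: "x \<in> topspace X"
    using V openin_subset by blast
  fix a assume "a \<in> carrier (hawaiian_group X x)"
  then obtain f where f: "f \<in> hawaiian_maps X x" "a = hawaiian_homotopic X x `` {f}"
    by (auto simp: carrier_hawaiian_group elim: quotientE)
  obtain g h where g: "almost_trivial X x g" and h: "h \<in> hawaiian_maps (subtopology X V) x"
    and fgh: "(f, he_concat g h) \<in> hawaiian_homotopic X x"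
    by (rule hawaiian_map_factorization [OF V f(1)])
  have "a = weak_embedding X x (loop_classes X x g) \<otimes>\<^bsub>hawaiian_group X x\<^esub> hawaiian_homotopic X x `` {h}"
    using equiv_class_eq [OF equiv_hawaiian_homotopic fgh] f g h x
    by (simp add: weak_embedding_loop_classes mult_hawaiian_group almost_trivial_maps
        hawaiian_maps_subtopology [OF h])
  then show "\<exists>n\<in>carrier (weak_fundamental_product X x).
      \<exists>k\<in>hawaiian_group_map X x (\<lambda>z. z) ` carrier (hawaiian_group (subtopology X V) x).
        a = weak_embedding X x n \<otimes>\<^bsub>hawaiian_group X x\<^esub> k"
    unfolding hawaiian_group_map_inclusion_image
    by (intro bexI [of _ "loop_classes X x g"] bexI [of _ "hawaiian_homotopic X x `` {h}"]
        imageI h loop_classes_carrier x g)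
qed

text \<open>The neighbourhood in the definition need not be open, but loops in an open subset of it
  contract as well. Openness serves to factor maps and to recognise \<open>V\<close> as a
  wedge.\<close>

lemma semilocally_null_loops:
  assumes "semilocally_1_simply_connected_at X x"
  obtains V where "openin X V" "x \<in> V"
    "\<And>p. p \<in> loops (subtopology X V) x \<Longrightarrow> (p, \<lambda>t. x) \<in> loop_homotopic X x"
proof -
  obtain U V where V: "openin X V" "x \<in> V" "V \<subseteq> U"
    and triv: "\<forall>c\<in>carrier (fundamental_group (subtopology X U) x).
        fundamental_group_map X x (\<lambda>z. z) c = \<one>\<^bsub>fundamental_group X x\<^esub>"
    using assms by (auto simp: semilocally_1_simply_connected_at_def neighbourhood_in_def trivial_homomorphism_def)
  have "(p, \<lambda>t. x) \<in> loop_homotopic X x" if "p \<in> loops (subtopology X V) x" for p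
  proof -
    have p: "p \<in> loops (subtopology X U) x"
      using that by (rule loops_mono) (use V in auto)
    let ?c = "loop_homotopic (subtopology X U) x `` {p}"
    have "?c \<in> carrier (fundamental_group (subtopology X U) x)"
      using p by (simp add: carrier_fundamental_group quotientI)
    then have "fundamental_group_map X x (\<lambda>z. z) ?c = loop_homotopic X x `` {\<lambda>t. x}"
      using triv by (simp add: one_fundamental_group)
    moreover have "p \<in> ?c"
      using p by (simp flip: loops_iff)
    moreover have "((\<lambda>z. z) \<circ> p, p) \<in> loop_homotopic X x"
      using p loop_homotopic_subtopology by (fastforce simp: loops_iff o_def)
    ultimately have "p \<in> loop_homotopic X x `` {\<lambda>t. x}"
      unfolding fundamental_group_map_def by blast
    then show ?thesis
      by (simp add: loop_homotopic_sym)
  qed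
  then show ?thesis
    using that V by blast
qed

section \<open>Open subspaces of a wedge\<close>

lemma topspace_wedge: "topspace (wedge X x Y y) = wedge_collapse x y ` (topspace X <+> topspace Y)"
  by (simp add: wedge_def topspace_quotient_topology topspace_disjoint_sum_topology)

lemma openin_wedge:
  "openin (wedge X x Y y) W \<longleftrightarrow> W \<subseteq> topspace (wedge X x Y y) \<and>
     openin X {a \<in> topspace X. wedge_collapse x y (Inl a) \<in> W} \<and>
     openin Y {b \<in> topspace Y. wedge_collapse x y (Inr b) \<in> W}"
proof -
  have "Inl -` {p \<in> topspace X <+> topspace Y. wedge_collapse x y p \<in> W} = {a \<in> topspace X. wedge_collapse x y (Inl a) \<in> W}"
    "Inr -` {p \<in> topspace X <+> topspace Y. wedge_collapse x y p \<in> W} = {b \<in> topspace Y. wedge_collapse x y (Inr b) \<in> W}"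
    by auto
  then show ?thesis
    by (simp add: wedge_def openin_quotient_topology openin_disjoint_sum_topology
        topspace_quotient_topology topspace_disjoint_sum_topology)
qed

text \<open>The traces \<open>?A\<close> and \<open>?B\<close> of an open \<open>V\<close> are open,
  so a subset of \<open>V\<close> has open traces in the subspaces exactly when it has them in
  \<open>X\<close> and \<open>Y\<close>. Both wedges use the same representatives of points, so the
  topologies are equal and not merely homeomorphic.\<close>

lemma wedge_open_subspaces:
  assumes V: "openin (wedge X x Y y) V"
  shows "wedge (subtopology X {a \<in> topspace X. wedge_collapse x y (Inl a) \<in> V}) x
      (subtopology Y {b \<in> topspace Y. wedge_collapse x y (Inr b) \<in> V}) y = subtopology (wedge X x Y y) V"
    (is "wedge (subtopology X ?A) x (subtopology Y ?B) y = _")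
proof -
  have A: "openin X ?A" and B: "openin Y ?B" and V_sub: "V \<subseteq> topspace (wedge X x Y y)"
    using V by (simp_all add: openin_wedge)
  have top: "wedge_collapse x y ` (?A <+> ?B) = V"
    using V_sub by (auto simp: topspace_wedge)
  have "openin (wedge (subtopology X ?A) x (subtopology Y ?B) y) W \<longleftrightarrow> openin (subtopology (wedge X x Y y) V) W" for W
  proof (cases "W \<subseteq> V")
    case True
    have "{a \<in> topspace X \<inter> ?A. wedge_collapse x y (Inl a) \<in> W} = {a \<in> topspace X. wedge_collapse x y (Inl a) \<in> W}"
      "{b \<in> topspace Y \<inter> ?B. wedge_collapse x y (Inr b) \<in> W} = {b \<in> topspace Y. wedge_collapse x y (Inr b) \<in> W}"
      using True by auto
    moreover have "topspace X \<inter> ?A = ?A" "topspace Y \<inter> ?B = ?B"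
      by auto
    moreover have "{a \<in> topspace X. wedge_collapse x y (Inl a) \<in> W} \<subseteq> ?A"
      "{b \<in> topspace Y. wedge_collapse x y (Inr b) \<in> W} \<subseteq> ?B"
      using True by auto
    moreover have "W \<subseteq> topspace (wedge X x Y y)"
      using True V_sub by (rule subset_trans)
    moreover have "openin (subtopology (wedge X x Y y) V) W \<longleftrightarrow> openin (wedge X x Y y) W"
      using True V by (simp add: openin_open_subtopology)
    ultimately show ?thesis
      using True
      by (simp add: openin_wedge [of "subtopology X ?A"] topspace_wedge [of "subtopology X ?A"] top
          openin_open_subtopology A B openin_wedge [of X])
  next
    case False
    moreover have "\<not> openin (wedge (subtopology X ?A) x (subtopology Y ?B) y) W"
    proof
      assume "openin (wedge (subtopology X ?A) x (subtopology Y ?B) y) W"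
      then have "W \<subseteq> wedge_collapse x y ` (topspace X \<inter> ?A <+> topspace Y \<inter> ?B)"
        by (simp add: openin_wedge topspace_wedge)
      also have "topspace X \<inter> ?A = ?A"
        by auto
      also have "topspace Y \<inter> ?B = ?B"
        by auto
      finally show False
        using False top by simp
    qed
    ultimately show ?thesis
      using V by (simp add: openin_open_subtopology)
  qed
  then show ?thesis
    by (simp add: topology_eq)
qed

theorem theorem3p1:
  fixes X1 :: "'a topology" and X2 :: "'b topology" and x1 :: 'a and x2 :: 'b
    and X :: "('a + 'b) topology" and x :: "'a + 'b"
  assumes "x1 \<in> topspace X1" and "x2 \<in> topspace X2"
    and "X = wedge X1 x1 X2 x2" and "x = Inl x1"
    and "semilocally_1_simply_connected_at X x"
  shows "\<exists>U1 U2 U H N.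
      neighbourhood_in X1 x1 U1 \<and> neighbourhood_in X2 x2 U2 \<and>
      U = wedge (subtopology X1 U1) x1 (subtopology X2 U2) x2 \<and>
      neighbourhood_in X x (topspace U) \<and>
      H = (hawaiian_group X x)
        \<lparr>carrier := hawaiian_group_map X x (\<lambda>z. z) ` carrier (hawaiian_group U x)\<rparr> \<and>
      N = weak_fundamental_product X x \<and>
      (\<exists>\<phi> \<in> hom H (AutoGroup N).
        (\<lambda>(h, n). weak_embedding X x n \<otimes>\<^bsub>hawaiian_group X x\<^esub> h)
          \<in> iso (semidirect_product H \<phi> N) (hawaiian_group X x))"
proof -
  obtain V where V: "openin X V" "x \<in> V"
    and null: "\<And>p. p \<in> loops (subtopology X V) x \<Longrightarrow> (p, \<lambda>t. x) \<in> loop_homotopic X x"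
    using semilocally_null_loops [OF assms(5)] by blast
  define U1 where "U1 = {a \<in> topspace X1. wedge_collapse x1 x2 (Inl a) \<in> V}"
  define U2 where "U2 = {b \<in> topspace X2. wedge_collapse x1 x2 (Inr b) \<in> V}"
  have "openin X1 U1" "openin X2 U2" and V_sub: "V \<subseteq> topspace X"
    using V(1) by (simp_all add: assms(3) openin_wedge U1_def U2_def)
  moreover have "x1 \<in> U1" "x2 \<in> U2"
    \<comment> \<open>\<open>wedge_collapse\<close> sends both base points to \<open>x\<close>, so
      one membership in \<open>V\<close> settles both traces.\<close>
    using V(2) assms(1,2,4) by (auto simp: U1_def U2_def wedge_collapse_def)
  ultimately have U1: "neighbourhood_in X1 x1 U1" and U2: "neighbourhood_in X2 x2 U2"
    by (auto simp: neighbourhood_in_def openin_subset)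
  have U: "wedge (subtopology X1 U1) x1 (subtopology X2 U2) x2 = subtopology X V"
    using V(1) unfolding assms(3) U1_def U2_def by (rule wedge_open_subspaces)
  have nbhd: "neighbourhood_in X x (topspace (subtopology X V))"
    using V V_sub by (auto simp: neighbourhood_in_def)
  show ?thesis
    by (intro exI conjI, rule U1, rule U2, rule U [symmetric], rule nbhd, rule refl, rule refl,
        rule hawaiian_group_semidirect [OF V null refl])
qed

end
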